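(* Define $$R^{\bullet}(\lambda;\tau;p)=\sum_{|\mu|\ge 0}\Big(\sum_{|\nu|=|\mu|}\frac{\chi_\nu(C(\mu))}{z_\mu}\,e^{\sqrt{-1}(\tau+\frac12)\kappa_\nu\lambda/2}\,V_\nu(\lambda)\Big)p_\mu$$ and $$R(\lambda;\tau;p)=\sum_{n\ge1}\frac{(-1)^{n-1}}{n}\sum_{\mu}\Big(\sum_{\cup_{i=1}^n\mu^i=\mu}\ \prod_{i=1}^n\ \sum_{|\nu^i|=|\mu^i|}\frac{\chi_{\nu^i}(C(\mu^i))}{z_{\mu^i}}\,e^{\sqrt{-1}(\tau+\frac12)\kappa_{\nu^i}\lambda/2}\,V_{\nu^i}(\lambda)\Big)p_\mu .$$ Then the following two equivalent equations are satisfied: $$\frac{\partial R}{\partial\tau}=\frac{\sqrt{-1}\lambda}{2}\sum_{i,j\ge1}\Big(ij\,p_{i+j}\frac{\partial^2R}{\partial p_i\partial p_j}+ij\,p_{i+j}\frac{\partial R}{\partial p_i}\frac{\partial R}{\partial p_j}+(i+j)p_ip_j\frac{\partial R}{\partial p_{i+j}}\Big),$$ $$\frac{\partial R^{\bullet}}{\partial\tau}=\frac{\sqrt{-1}\lambda}{2}\sum_{i,j\ge1}\Big(ij\,p_{i+j}\frac{\partial^2R^{\bullet}}{\partial p_i\partial p_j}+(i+j)p_ip_j\frac{\partial R^{\bullet}}{\partial p_{i+j}}\Big).$$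
   Context: A partition $\mu=(\mu_1\ge\dots\ge\mu_{l}>0)$ has size $|\mu|=\sum_i\mu_i$ and length $l(\mu)=l$; $m_j(\mu)$ is the number of parts equal to $j$; $z_\mu=\prod_j m_j(\mu)!\,j^{m_j(\mu)}$; $\kappa_\mu=\sum_{i=1}^{l(\mu)}\mu_i(\mu_i-2i+1)$. $C(\mu)$ is the conjugacy class of $S_{|\mu|}$ of cycle type $\mu$, and $\chi_\nu(C(\mu))$ is the value on it of the irreducible character $\chi_\nu$ of the symmetric group indexed by $\nu$, normalized so that the Schur function is $s_\nu=\sum_{|\mu|=|\nu|}\frac{\chi_\nu(C(\mu))}{z_\mu}p_\mu$ ($\chi_{(d)}$ is trivial, $\chi_{(1^d)}$ is the sign). $p=(p_1,p_2,\dots)$ are formal variables, $p_\mu=p_{\mu_1}\cdots p_{\mu_{l(\mu)}}$, and $R,R^\bullet$ are formal power series in $p$ whose coefficients are functions of $\tau$ and (meromorphic) of $\lambda$. The term of $R^\bullet$ for the empty partition is $1$. Moreover $$V_\nu(\lambda)=\prod_{1\le a<b\le l(\nu)}\frac{\sin[(\nu_a-\nu_b+b-a)\lambda/2]}{\sin[(b-a)\lambda/2]}\cdot\frac{1}{\prod_{i=1}^{l(\nu)}\prod_{v=1}^{\nu_i}2\sin[(v-i+l(\nu))\lambda/2]}.$$ In $R$, the sum $\sum_{\mu}$ is over nonempty partitions and $\sum_{\cup_{i=1}^n\mu^i=\mu}$ is over ordered $n$-tuples of nonempty partitions $(\mu^1,\dots,\mu^n)$ whose multiset union of parts is $\mu$;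 thus $R=\log R^\bullet$. *)

theory Defs
  imports
    Complex_Main
    "HOL-Library.Multiset"
    "HOL-Library.Function_Algebras"
    "HOL-Combinatorics.Permutations"
    "HOL-Combinatorics.Orbits"
begin

section \<open>Partitions\<close>

text \<open>
  A partition \<open>\<mu>\<close> is the multiset of its parts, a multiset of positive naturals. Thus
  \<open>size \<mu>\<close> is the length, \<open>sum_mset \<mu>\<close> is \<open>|\<mu>|\<close>, \<open>count \<mu> j\<close> is \<open>m\<^sub>j(\<mu>)\<close>, and the union
  of the parts of two partitions is their sum as multisets.
\<close>

definition is_partition :: "nat multiset \<Rightarrow> bool" where
  "is_partition \<mu> \<longleftrightarrow> 0 \<notin># \<mu>"

definition partitions_of :: "nat \<Rightarrow> nat multiset set" where
  "partitions_of d = {\<mu>. is_partition \<mu> \<and> sum_mset \<mu> = d}"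

text \<open>\<open>part \<mu> i\<close> is \<open>\<mu>\<^sub>i\<close>, the \<open>i\<close>-th largest part, for \<open>1 \<le> i \<le> size \<mu>\<close>.\<close>

definition part :: "nat multiset \<Rightarrow> nat \<Rightarrow> nat" where
  "part \<mu> i = rev (sorted_list_of_multiset \<mu>) ! (i - 1)"

definition z_part :: "nat multiset \<Rightarrow> nat" where
  "z_part \<mu> = (\<Prod>j\<in>set_mset \<mu>. fact (count \<mu> j) * j ^ count \<mu> j)"

definition kappa :: "nat multiset \<Rightarrow> int" where
  "kappa \<mu> = (\<Sum>i=1..size \<mu>. int (part \<mu> i) * (int (part \<mu> i) - 2 * int i + 1))"


section \<open>Irreducible characters of the symmetric group\<close>

text \<open>
  The symmetric group \<open>S\<^sub>d\<close> is \<open>{\<sigma>. \<sigma> permutes {1..d}}\<close> under composition. Its group algebra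
  over the complex numbers consists of the functions vanishing outside of it.
\<close>

definition cycle_type :: "nat \<Rightarrow> (nat \<Rightarrow> nat) \<Rightarrow> nat multiset" where
  "cycle_type d \<sigma> = image_mset card (mset_set (orbit \<sigma> ` {1..d}))"

definition conj_class :: "nat multiset \<Rightarrow> (nat \<Rightarrow> nat) set" where
  "conj_class \<mu> = {\<sigma>. \<sigma> permutes {1..sum_mset \<mu>} \<and> cycle_type (sum_mset \<mu>) \<sigma> = \<mu>}"

type_synonym galg = "(nat \<Rightarrow> nat) \<Rightarrow> complex"

definition galg_scale :: "complex \<Rightarrow> galg \<Rightarrow> galg" where
  "galg_scale c f = (\<lambda>\<sigma>. c * f \<sigma>)"

global_interpretation galg: vector_space galg_scale
  by unfold_locales (auto simp: galg_scale_def fun_eq_iff algebra_simps)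

text \<open>Left multiplication by the group element \<open>g\<close>.\<close>

definition left_mult :: "(nat \<Rightarrow> nat) \<Rightarrow> galg \<Rightarrow> galg" where
  "left_mult g f = (\<lambda>\<sigma>. f (inv g \<circ> \<sigma>))"

text \<open>
  \<open>cell \<nu> k\<close> is the cell (row, column) of the Young diagram of \<open>\<nu>\<close> that contains the entry
  \<open>k \<in> {1..|\<nu>|}\<close> in the tableau filled row by row.
\<close>

definition cells :: "nat multiset \<Rightarrow> (nat \<times> nat) list" where
  "cells \<nu> = concat (map (\<lambda>i. map (\<lambda>j. (i, j)) [1..<Suc (part \<nu> i)]) [1..<Suc (size \<nu>)])"

definition cell :: "nat multiset \<Rightarrow> nat \<Rightarrow> nat \<times> nat" where
  "cell \<nu> k = cells \<nu> ! (k - 1)"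

definition row_group :: "nat multiset \<Rightarrow> (nat \<Rightarrow> nat) set" where
  "row_group \<nu> = {\<sigma>. \<sigma> permutes {1..sum_mset \<nu>} \<and>
     (\<forall>k\<in>{1..sum_mset \<nu>}. fst (cell \<nu> (\<sigma> k)) = fst (cell \<nu> k))}"

definition column_group :: "nat multiset \<Rightarrow> (nat \<Rightarrow> nat) set" where
  "column_group \<nu> = {\<sigma>. \<sigma> permutes {1..sum_mset \<nu>} \<and>
     (\<forall>k\<in>{1..sum_mset \<nu>}. snd (cell \<nu> (\<sigma> k)) = snd (cell \<nu> k))}"

text \<open>
  The Young symmetrizer: the product in the group algebra of the sum of the row group and
  the signed sum of the column group.
\<close>

definition young_symmetrizer :: "nat multiset \<Rightarrow> galg" where
  "young_symmetrizer \<nu> = (\<lambda>\<sigma>. \<Sum>(p, q) | p \<in> row_group \<nu> \<and> q \<in> column_group \<nu> \<and> p \<circ> q = \<sigma>.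
     of_int (sign q))"

text \<open>
  The irreducible representation indexed by \<open>\<nu>\<close>: the left ideal generated by the Young
  symmetrizer, on which the group acts by left multiplication. With this convention
  \<open>\<nu> = (d)\<close> gives the trivial and \<open>\<nu> = (1\<^sup>d)\<close> the sign representation, and \<open>s\<^sub>\<nu>\<close> is the
  Frobenius characteristic of the character.
\<close>

definition specht :: "nat multiset \<Rightarrow> galg set" where
  "specht \<nu> = galg.span ((\<lambda>g. left_mult g (young_symmetrizer \<nu>)) ` {g. g permutes {1..sum_mset \<nu>}})"

text \<open>The trace of a linear map on an invariant finite-dimensional subspace \<open>W\<close>.\<close>

definition trace_on :: "galg set \<Rightarrow> (galg \<Rightarrow> galg) \<Rightarrow> complex" where
  "trace_on W f =
     (let B = (SOME B. galg.independent B \<and> galg.span B = W)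
      in \<Sum>b\<in>B. galg.representation B (f b) b)"

definition irr_char :: "nat multiset \<Rightarrow> (nat \<Rightarrow> nat) \<Rightarrow> complex" where
  "irr_char \<nu> g = trace_on (specht \<nu>) (left_mult g)"

text \<open>\<open>chi \<nu> \<mu>\<close> is \<open>\<chi>\<^sub>\<nu>(C(\<mu>))\<close>, only meaningful for \<open>|\<nu>| = |\<mu>|\<close>.\<close>

definition chi :: "nat multiset \<Rightarrow> nat multiset \<Rightarrow> complex" where
  "chi \<nu> \<mu> = irr_char \<nu> (SOME g. g \<in> conj_class \<mu>)"


section \<open>Formal power series in \<open>p\<^sub>1, p\<^sub>2, \<dots>\<close>\<close>

text \<open>
  A formal power series is its coefficient function; the multiset \<open>\<mu>\<close> stands for the monomial
  \<open>p\<^sub>\<mu>\<close>, and the coefficient of \<open>p\<^sub>\<mu>\<close> is zero whenever \<open>\<mu>\<close> contains the index \<open>0\<close>.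
\<close>

type_synonym pseries = "nat multiset \<Rightarrow> complex"

definition p_mult :: "nat \<Rightarrow> pseries \<Rightarrow> pseries" where
  "p_mult i F = (\<lambda>\<mu>. if i \<in># \<mu> then F (\<mu> - {#i#}) else 0)"

definition p_deriv :: "nat \<Rightarrow> pseries \<Rightarrow> pseries" where
  "p_deriv i F = (\<lambda>\<mu>. of_nat (count \<mu> i + 1) * F (add_mset i \<mu>))"

definition ps_mult :: "pseries \<Rightarrow> pseries \<Rightarrow> pseries" where
  "ps_mult F G = (\<lambda>\<mu>. \<Sum>\<alpha> | \<alpha> \<subseteq># \<mu>. F \<alpha> * G (\<mu> - \<alpha>))"

text \<open>Infinite sums of formal power series: every monomial occurs in only finitely many terms.\<close>

definition formally_summable :: "('i \<Rightarrow> pseries) \<Rightarrow> 'i set \<Rightarrow> bool" where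
  "formally_summable F A \<longleftrightarrow> (\<forall>\<mu>. finite {i \<in> A. F i \<mu> \<noteq> 0})"

definition formal_sum :: "('i \<Rightarrow> pseries) \<Rightarrow> 'i set \<Rightarrow> pseries" where
  "formal_sum F A = (\<lambda>\<mu>. \<Sum>i | i \<in> A \<and> F i \<mu> \<noteq> 0. F i \<mu>)"

definition has_formal_sum :: "('i \<Rightarrow> pseries) \<Rightarrow> 'i set \<Rightarrow> pseries \<Rightarrow> bool" where
  "has_formal_sum F A S \<longleftrightarrow> formally_summable F A \<and> S = formal_sum F A"

text \<open>Differentiation of a family of series with respect to a complex parameter.\<close>

definition has_coeff_derivative :: "(complex \<Rightarrow> pseries) \<Rightarrow> pseries \<Rightarrow> complex \<Rightarrow> bool" where
  "has_coeff_derivative F D t \<longleftrightarrow> (\<forall>\<mu>. ((\<lambda>s. F s \<mu>) has_field_derivative D \<mu>) (at t))"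


section \<open>The series \<open>R\<close> and its exponential\<close>

text \<open>
  \<open>V \<nu>\<close> is meromorphic. Where a denominator vanishes, the value is the conventional one given
  by \<open>x / 0 = 0\<close>.
\<close>

definition V :: "nat multiset \<Rightarrow> complex \<Rightarrow> complex" where
  "V \<nu> lam =
     (\<Prod>(a, b) | 1 \<le> a \<and> a < b \<and> b \<le> size \<nu>.
        sin (of_int (int (part \<nu> a) - int (part \<nu> b) + int b - int a) * lam / 2)
        / sin (of_int (int b - int a) * lam / 2))
     * (1 / (\<Prod>i=1..size \<nu>. \<Prod>v=1..part \<nu> i.
              2 * sin (of_int (int v - int i + int (size \<nu>)) * lam / 2)))"

definition R_bullet_coeff :: "complex \<Rightarrow> complex \<Rightarrow> nat multiset \<Rightarrow> complex" where
  "R_bullet_coeff lam \<tau> \<mu> =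
     (\<Sum>\<nu>\<in>partitions_of (sum_mset \<mu>).
        chi \<nu> \<mu> / of_nat (z_part \<mu>)
        * exp (\<i> * (\<tau> + 1 / 2) * of_int (kappa \<nu>) * lam / 2) * V \<nu> lam)"

definition R_bullet :: "complex \<Rightarrow> complex \<Rightarrow> pseries" where
  "R_bullet lam \<tau> = (\<lambda>\<mu>. if is_partition \<mu> then R_bullet_coeff lam \<tau> \<mu> else 0)"

text \<open>Ordered \<open>n\<close>-tuples of nonempty partitions with union \<open>\<mu>\<close>.\<close>

definition splittings :: "nat \<Rightarrow> nat multiset \<Rightarrow> nat multiset list set" where
  "splittings n \<mu> = {ms. length ms = n \<and> (\<forall>\<xi>\<in>set ms. is_partition \<xi> \<and> \<xi> \<noteq> {#}) \<and> sum_list ms = \<mu>}"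

text \<open>
  For \<open>n \<ge> 1\<close> there are no splittings of \<open>{#}\<close> nor of a multiset containing \<open>0\<close>, so only the
  monomials of nonempty partitions occur.
\<close>

definition R_term :: "complex \<Rightarrow> complex \<Rightarrow> nat \<Rightarrow> pseries" where
  "R_term lam \<tau> n =
     (\<lambda>\<mu>. (-1) ^ (n - 1) / of_nat n *
        (\<Sum>ms\<in>splittings n \<mu>. \<Prod>\<xi>\<leftarrow>ms. R_bullet_coeff lam \<tau> \<xi>))"

definition R :: "complex \<Rightarrow> complex \<Rightarrow> pseries" where
  "R lam \<tau> = formal_sum (R_term lam \<tau>) {1..}"


section \<open>Finiteness of the sums over partitions and splittings\<close>

lemma finite_submultisets: "finite {\<alpha>. \<alpha> \<subseteq># (\<mu> :: 'a multiset)}"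
proof (rule finite_subset)
  show "{\<alpha>. \<alpha> \<subseteq># \<mu>} \<subseteq> mset ` {xs. set xs \<subseteq> set_mset \<mu> \<and> length xs \<le> size \<mu>}"
  proof
    fix \<alpha> assume "\<alpha> \<in> {\<alpha>. \<alpha> \<subseteq># \<mu>}"
    moreover obtain xs where "\<alpha> = mset xs" by (metis ex_mset)
    ultimately show "\<alpha> \<in> mset ` {xs. set xs \<subseteq> set_mset \<mu> \<and> length xs \<le> size \<mu>}"
      using set_mset_mono[of \<alpha> \<mu>] size_mset_mono[of \<alpha> \<mu>] by auto
  qed
qed (intro finite_imageI finite_lists_length_le finite_set_mset)

lemma size_le_sum_mset: "is_partition \<mu> \<Longrightarrow> size \<mu> \<le> sum_mset \<mu>"
  by (induction \<mu>) (auto simp: is_partition_def)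

lemma finite_partitions_of: "finite (partitions_of d)"
proof (rule finite_subset)
  show "partitions_of d \<subseteq> mset ` {xs. set xs \<subseteq> {..d} \<and> length xs \<le> d}"
  proof
    fix \<mu> assume \<mu>: "\<mu> \<in> partitions_of d"
    then have "size \<mu> \<le> d" using size_le_sum_mset by (auto simp: partitions_of_def)
    moreover have "x \<le> d" if "x \<in># \<mu>" for x
      using \<mu> that by (auto simp: partitions_of_def sum_mset.remove)
    moreover obtain xs where "\<mu> = mset xs" by (metis ex_mset)
    ultimately show "\<mu> \<in> mset ` {xs. set xs \<subseteq> {..d} \<and> length xs \<le> d}" by auto
  qed
qed (intro finite_imageI finite_lists_length_le finite_atMost)

lemma in_sum_list_subset: "\<xi> \<in> set ms \<Longrightarrow> \<xi> \<subseteq># sum_list (ms :: 'a multiset list)"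
proof (induction ms)
  case (Cons \<zeta> ms)
  then show ?case
    by (metis mset_subset_eq_add_left mset_subset_eq_add_right set_ConsD subset_mset.order_trans
        sum_list.Cons)
qed simp

lemma finite_splittings: "finite (splittings n \<mu>)"
proof (rule finite_subset)
  show "splittings n \<mu> \<subseteq> {ms. set ms \<subseteq> {\<alpha>. \<alpha> \<subseteq># \<mu>} \<and> length ms = n}"
    using in_sum_list_subset by (auto simp: splittings_def)
qed (intro finite_lists_length_eq finite_submultisets)

lemma length_le_size_sum_list:
  "\<forall>\<xi>\<in>set ms. \<xi> \<noteq> {#} \<Longrightarrow> length ms \<le> size (sum_list (ms :: 'a multiset list))"
proof (induction ms)
  case (Cons \<xi> ms)
  then have "size \<xi> \<ge> 1" by (simp add: Suc_leI nonempty_has_size)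
  with Cons show ?case by simp
qed simp

lemma splittings_empty: "size \<mu> < n \<Longrightarrow> splittings n \<mu> = {}"
proof (rule ccontr)
  assume n: "size \<mu> < n" and "splittings n \<mu> \<noteq> {}"
  then obtain ms where "ms \<in> splittings n \<mu>" by blast
  then have "length ms = n" "\<forall>\<xi>\<in>set ms. \<xi> \<noteq> {#}" "sum_list ms = \<mu>"
    unfolding splittings_def by blast+
  with length_le_size_sum_list[of ms] n show False by simp
qed

lemma formally_summable_R_term: "formally_summable (R_term lam \<tau>) {1..}"
  unfolding formally_summable_def
proof
  fix \<mu>
  have "R_term lam \<tau> n \<mu> = 0" if "size \<mu> < n" for n
    unfolding R_term_def splittings_empty[OF that] by simp
  then have "{n \<in> {1..}. R_term lam \<tau> n \<mu> \<noteq> 0} \<subseteq> {..size \<mu>}"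
    using leI by blast
  then show "finite {n \<in> {1..}. R_term lam \<tau> n \<mu> \<noteq> 0}"
    by (rule finite_subset) simp
qed


section \<open>The term of the empty partition is 1\<close>

lemma chi_empty: "chi {#} {#} = 1"
proof -
  let ?c = "young_symmetrizer {#}"
  have rg: "row_group {#} = {id}" "column_group {#} = {id}"
    by (auto simp: row_group_def column_group_def)
  have "{(p, q). p \<in> row_group {#} \<and> q \<in> column_group {#} \<and> p \<circ> q = id} = {(id, id)}"
    unfolding rg by auto
  then have c1: "?c id = 1" unfolding young_symmetrizer_def by (simp add: sign_id)
  then have c0: "?c \<noteq> 0" by (metis zero_fun_def zero_neq_one)
  have lm: "left_mult id f = f" for f by (simp add: left_mult_def)
  have W: "specht {#} = galg.span {?c}" by (simp add: specht_def lm)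
  have cls: "conj_class {#} = {id}" by (auto simp: conj_class_def cycle_type_def)
  define B where "B = (SOME B. galg.independent B \<and> galg.span B = specht {#})"
  have "galg.independent {?c} \<and> galg.span {?c} = specht {#}"
    using c0 W by simp
  then have "galg.independent B \<and> galg.span B = specht {#}"
    unfolding B_def by (rule someI)
  then have B: "galg.independent B" "galg.span B = specht {#}" by blast+
  have "card B = card {?c}"
    using B W c0 galg.dim_eq_card[of B "{?c}"] galg.dim_eq_card[of "{?c}" "{?c}"] by simp
  moreover have "galg.representation B b b = 1" if "b \<in> B" for b
    using galg.representation_basis[OF B(1) that] by simp
  ultimately have "(\<Sum>b\<in>B. galg.representation B b b) = 1" by simp
  then show ?thesis
    by (simp add: chi_def irr_char_def trace_on_def cls lm B_def)
qed

lemma R_bullet_empty: "R_bullet lam \<tau> {#} = 1"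
proof -
  have "partitions_of 0 = {{#}}"
  proof
    show "partitions_of 0 \<subseteq> {{#}}"
    proof
      fix \<mu> assume "\<mu> \<in> partitions_of 0"
      then have "is_partition \<mu>" "sum_mset \<mu> = 0" unfolding partitions_of_def by blast+
      then have "size \<mu> \<le> 0" using size_le_sum_mset[of \<mu>] by presburger
      then show "\<mu> \<in> {{#}}" by simp
    qed
  qed (simp add: partitions_of_def is_partition_def)
  moreover have "V {#} lam = 1"
  proof -
    have "{(a, b). 1 \<le> a \<and> a < b \<and> b \<le> size ({#} :: nat multiset)} = {}" by auto
    then show ?thesis unfolding V_def by (simp only: prod.empty) simp
  qed
  ultimately show ?thesis
    by (simp add: R_bullet_def R_bullet_coeff_def is_partition_def chi_empty z_part_def kappa_def)
qed

end

theory Submission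
  imports Defs
begin

text \<open>
  Multiplication by the sum of all transpositions acts on the left ideal of the Young symmetrizer
  of \<open>\<nu>\<close> as the scalar \<open>\<kappa>\<^sub>\<nu> / 2\<close>, the sum of the contents of \<open>\<nu>\<close>. Taking traces turns
  \<open>\<kappa>\<^sub>\<nu> \<chi>\<^sub>\<nu>(g)\<close> into the sum of \<open>\<chi>\<^sub>\<nu>((x y) g)\<close> over ordered pairs \<open>x \<noteq> y\<close>. Multiplying \<open>g\<close> by
  \<open>(x y)\<close> cuts a cycle containing both points and joins the cycles of \<open>x\<close> and \<open>y\<close> otherwise, so
  this sum is the coefficient of the cut-and-join operator applied to the series of \<open>\<chi>\<^sub>\<nu> / z\<close>.
  Since \<open>\<tau>\<close> enters only through \<open>exp (\<i> (\<tau> + 1/2) \<kappa>\<^sub>\<nu> \<lambda> / 2)\<close>, this is the equation for \<open>R\<^sup>\<bullet>\<close>.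
  The equation for \<open>R\<close> follows because \<open>R\<^sup>\<bullet> \<cdot> D R = D R\<^sup>\<bullet>\<close> for every derivation \<open>D\<close> and \<open>R\<^sup>\<bullet>\<close> has
  constant term 1, hence can be cancelled.
\<close>

section \<open>Traces and class functions\<close>

text \<open>The sum of all transpositions is invariant under conjugation, so its action on the whole
  left ideal is decided on the Young symmetrizer. There, after summing over the row group, a pair of
  entries contributes +1 if they share a row, -1 if they share a column and 0 otherwise, which
  reduces the scalar to a count of cells. Ordered pairs count each transposition twice; this gives
  \<open>kappa\<close> rather than its half and matches the factor that the exponential yields under
  differentiation.

  Two choices by \<open>SOME\<close> have to be controlled. For the basis in
  \<open>trace_on\<close>, linearity and cyclicity are proved for the chosen basis itself. For the
  representative in \<open>chi\<close>, conjugation invariance is combined with the fact that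
  permutations of equal cycle type are conjugate.

  The factor \<open>1 / z_part\<close> turns the multiplicities produced by differentiation into
  numbers of points on cycles. On the side of series, everything must become finite at a fixed
  monomial: the logarithm is truncated by the number of parts, the sum over pairs
  \<open>(i, j)\<close> by the sum of the parts.\<close>

lemma linear_left_mult: "Vector_Spaces.linear galg_scale galg_scale (left_mult g)"
  by (intro Vector_Spaces.linear.intro galg.vector_space_axioms module_hom.intro galg.module_axioms
      module_hom_axioms.intro) (auto simp: left_mult_def galg_scale_def plus_fun_def)

lemma left_mult_comp:
  assumes "bij g" "bij h"
  shows "left_mult (g \<circ> h) f = left_mult g (left_mult h f)"
  using assms by (simp add: left_mult_def o_inv_distrib o_assoc)

lemma specht_invariant:
  assumes g: "g permutes {1..sum_mset \<nu>}" and w: "w \<in> specht \<nu>"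
  shows "left_mult g w \<in> specht \<nu>"
proof -
  interpret Vector_Spaces.linear galg_scale galg_scale "left_mult g" by (rule linear_left_mult)
  let ?X = "(\<lambda>h. left_mult h (young_symmetrizer \<nu>)) ` {h. h permutes {1..sum_mset \<nu>}}"
  have "left_mult g ` ?X \<subseteq> ?X"
  proof (clarsimp)
    fix h assume h: "h permutes {Suc 0..sum_mset \<nu>}"
    have "left_mult g (left_mult h (young_symmetrizer \<nu>)) = left_mult (g \<circ> h) (young_symmetrizer \<nu>)"
      using g h by (simp add: left_mult_comp permutes_bij)
    then show "left_mult g (left_mult h (young_symmetrizer \<nu>))
      \<in> (\<lambda>h. left_mult h (young_symmetrizer \<nu>)) ` {h. h permutes {Suc 0..sum_mset \<nu>}}"
      using g h by (auto intro!: imageI permutes_compose)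
  qed
  then have "galg.span (left_mult g ` ?X) \<subseteq> galg.span ?X"
    by (rule galg.span_mono)
  moreover have "left_mult g w \<in> left_mult g ` galg.span ?X"
    using w by (simp add: specht_def)
  ultimately show ?thesis by (auto simp: span_image specht_def)
qed

text \<open>The basis that \<open>trace_on\<close> picks. Giving it a name lets every trace identity
  be proved for this one basis, so no two bases are ever compared.\<close>

definition spec_basis :: "galg set \<Rightarrow> galg set" where
  "spec_basis W = (SOME B. galg.independent B \<and> galg.span B = W)"

text \<open>A maximal independent subset of \<open>W\<close> shows that the choice is possible; the
  finite spanning set \<open>X\<close> bounds the size of independent sets. Finiteness matters
  because a sum over an infinite basis would default to 0.\<close>

lemma spec_basis:
  assumes "finite X" and "W = galg.span X"
  shows "galg.independent (spec_basis W)" "galg.span (spec_basis W) = W" "finite (spec_basis W)"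
    "\<And>b. b \<in> spec_basis W \<Longrightarrow> b \<in> W"
proof -
  obtain B where B: "B \<subseteq> W" "galg.independent B" "W \<subseteq> galg.span B"
    by (rule galg.maximal_independent_subset)
  have "galg.span B = W"
    using B assms by (metis galg.span_mono galg.span_span subset_antisym)
  with B have "galg.independent B \<and> galg.span B = W" by blast
  then have *: "galg.independent (spec_basis W) \<and> galg.span (spec_basis W) = W"
    unfolding spec_basis_def by (rule someI)
  then show "galg.independent (spec_basis W)" and W: "galg.span (spec_basis W) = W" by blast+
  with assms show "finite (spec_basis W)"
    using galg.independent_span_bound galg.span_superset by metis
  show "b \<in> W" if "b \<in> spec_basis W" for b
    using galg.span_base[OF that] unfolding W .
qed

lemma trace_on_eq: "trace_on W f = (\<Sum>b\<in>spec_basis W. galg.representation (spec_basis W) (f b) b)"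
  unfolding trace_on_def spec_basis_def Let_def ..

lemma trace_on_sum:
  assumes X: "finite X" and W: "W = galg.span X" and f: "\<And>i w. i \<in> I \<Longrightarrow> w \<in> W \<Longrightarrow> f i w \<in> W"
  shows "trace_on W (\<lambda>w. \<Sum>i\<in>I. f i w) = (\<Sum>i\<in>I. trace_on W (f i))"
proof -
  note B = spec_basis[OF X W]
  have "galg.representation (spec_basis W) (\<Sum>i\<in>I. f i b) b =
      (\<Sum>i\<in>I. galg.representation (spec_basis W) (f i b) b)" if "b \<in> spec_basis W" for b
    using that B f
    by (subst galg.representation_sum) auto
  then show ?thesis
    unfolding trace_on_eq by (simp add: sum.swap[of _ I])
qed

lemma trace_on_scale:
  assumes X: "finite X" and W: "W = galg.span X" and f: "\<And>w. w \<in> W \<Longrightarrow> f w \<in> W"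
  shows "trace_on W (\<lambda>w. galg_scale c (f w)) = c * trace_on W f"
proof -
  note B = spec_basis[OF X W]
  have "galg.representation (spec_basis W) (galg_scale c (f b)) b =
      c * galg.representation (spec_basis W) (f b) b" if "b \<in> spec_basis W" for b
    using that B f by (subst galg.representation_scale) auto
  then show ?thesis
    unfolding trace_on_eq by (simp add: sum_distrib_left)
qed

lemma trace_on_cong:
  assumes X: "finite X" and W: "W = galg.span X" and f: "\<And>w. w \<in> W \<Longrightarrow> f w = g w"
  shows "trace_on W f = trace_on W g"
  unfolding trace_on_eq using spec_basis(4)[OF X W] f by (intro sum.cong) auto

text \<open>The matrix argument: \<open>?r (f c) b\<close> is the entry of \<open>f\<close> in row
  \<open>b\<close> and column \<open>c\<close>, and both traces are the same double sum of products
  of entries, up to the order of summation.\<close>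

lemma trace_on_comp_commute:
  assumes X: "finite X" and W: "W = galg.span X"
    and f: "Vector_Spaces.linear galg_scale galg_scale f" "\<And>w. w \<in> W \<Longrightarrow> f w \<in> W"
    and g: "Vector_Spaces.linear galg_scale galg_scale g" "\<And>w. w \<in> W \<Longrightarrow> g w \<in> W"
  shows "trace_on W (f \<circ> g) = trace_on W (g \<circ> f)"
proof -
  note B = spec_basis[OF X W]
  let ?B = "spec_basis W"
  let ?r = "galg.representation ?B"
  have expand: "?r (f (g b)) b = (\<Sum>c\<in>?B. ?r (g b) c * ?r (f c) b)"
    if b: "b \<in> ?B" and f: "Vector_Spaces.linear galg_scale galg_scale f" "\<And>w. w \<in> W \<Longrightarrow> f w \<in> W"
      and g: "\<And>w. w \<in> W \<Longrightarrow> g w \<in> W" for b f g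
  proof -
    interpret Vector_Spaces.linear galg_scale galg_scale f by fact
    have "g b = (\<Sum>c\<in>?B. galg_scale (?r (g b) c) c)"
      using B g[OF B(4)[OF b]] by (subst galg.sum_representation_eq) auto
    then have "f (g b) = f (\<Sum>c\<in>?B. galg_scale (?r (g b) c) c)" by simp
    also have "\<dots> = (\<Sum>c\<in>?B. galg_scale (?r (g b) c) (f c))"
      by (simp add: sum scale)
    finally have "?r (f (g b)) b = (\<Sum>c\<in>?B. ?r (galg_scale (?r (g b) c) (f c)) b)"
      using B f(2) galg.span_scale[of _ "?B", unfolded B(2)] by (simp add: galg.representation_sum)
    also have "\<dots> = (\<Sum>c\<in>?B. ?r (g b) c * ?r (f c) b)"
      using B f(2) by (simp add: galg.representation_scale)
    finally show ?thesis .
  qed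
  have "trace_on W (f \<circ> g) = (\<Sum>b\<in>?B. \<Sum>c\<in>?B. ?r (g b) c * ?r (f c) b)"
    unfolding trace_on_eq using expand f g by simp
  also have "\<dots> = (\<Sum>c\<in>?B. \<Sum>b\<in>?B. ?r (f c) b * ?r (g b) c)"
    by (subst sum.swap) (simp add: mult.commute)
  also have "\<dots> = trace_on W (g \<circ> f)"
    unfolding trace_on_eq using expand f g by simp
  finally show ?thesis .
qed

text \<open>Cyclicity of the trace, applied to the factors \<open>h \<circ> g\<close> and
  \<open>inv h\<close>. It makes the value of \<open>chi\<close> independent of the chosen
  representative of the conjugacy class.\<close>

lemma irr_char_conj:
  assumes g: "g permutes {1..sum_mset \<nu>}" and h: "h permutes {1..sum_mset \<nu>}"
  shows "irr_char \<nu> (h \<circ> g \<circ> inv h) = irr_char \<nu> g"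
proof -
  let ?X = "(\<lambda>g. left_mult g (young_symmetrizer \<nu>)) ` {g. g permutes {1..sum_mset \<nu>}}"
  have X: "finite ?X" by (intro finite_imageI finite_permutations) simp
  note b = g[THEN permutes_bij] h[THEN permutes_bij] permutes_bij[OF permutes_inv[OF h]]
    bij_comp[OF permutes_bij[OF g] permutes_bij[OF h]]
  have "irr_char \<nu> (h \<circ> g \<circ> inv h) = trace_on (specht \<nu>) (left_mult (h \<circ> g) \<circ> left_mult (inv h))"
    unfolding irr_char_def by (intro arg_cong[where f = "trace_on _"]) (rule ext, simp only: left_mult_comp b o_apply)
  also have "\<dots> = trace_on (specht \<nu>) (left_mult (inv h) \<circ> left_mult (h \<circ> g))"
    using g h by (intro trace_on_comp_commute[OF X specht_def] linear_left_mult specht_invariant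
      permutes_compose permutes_inv)
  also have "left_mult (inv h) \<circ> left_mult (h \<circ> g) = left_mult (inv h \<circ> (h \<circ> g))"
    by (rule ext) (simp only: left_mult_comp b o_apply)
  also have "inv h \<circ> (h \<circ> g) = g"
    using h by (simp add: o_assoc permutes_inv_o)
  finally show ?thesis by (simp only: irr_char_def)
qed

section \<open>The sum of the transpositions on the Specht module\<close>

lemma length_sorted_list_of_multiset: "length (sorted_list_of_multiset M) = size M"
  by (metis mset_sorted_list_of_multiset size_mset)

lemma part_antimono:
  assumes "1 \<le> i" "i \<le> j" "j \<le> size \<nu>"
  shows "part \<nu> j \<le> part \<nu> i"
  using assms unfolding part_def
  by (subst (1 2) rev_nth) (auto intro!: sorted_nth_mono simp: diff_le_mono2 length_sorted_list_of_multiset)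

lemma sum_part: "(\<Sum>i=1..size \<nu>. part \<nu> i) = sum_mset \<nu>"
proof -
  have "sum_mset \<nu> = sum_list (rev (sorted_list_of_multiset \<nu>))"
    by (metis mset_rev mset_sorted_list_of_multiset sum_mset_sum_list)
  also have "\<dots> = (\<Sum>i=0..<size \<nu>. part \<nu> (i + 1))"
    by (simp add: sum_list_sum_nth part_def length_sorted_list_of_multiset)
  also have "\<dots> = (\<Sum>i=1..size \<nu>. part \<nu> i)"
    by (rule sum.reindex_bij_witness[of _ "\<lambda>i. i - 1" "\<lambda>i. i + 1"]) auto
  finally show ?thesis ..
qed

lemma set_cells: "set (cells \<nu>) = (SIGMA i:{1..size \<nu>}. {1..part \<nu> i})"
  by (auto simp: cells_def image_iff simp del: upt_Suc)

lemma length_cells: "length (cells \<nu>) = sum_mset \<nu>"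
  by (simp add: cells_def length_concat o_def interv_sum_list_conv_sum_set_nat
      atLeastLessThanSuc_atLeastAtMost sum_part[symmetric] del: upt_Suc)

text \<open>The list is as long as its set is large: both numbers are the sum of the parts.\<close>

lemma distinct_cells: "distinct (cells \<nu>)"
  using card_distinct[of "cells \<nu>"]
  by (simp add: set_cells length_cells sum_part[symmetric])

lemma bij_betw_cell: "bij_betw (cell \<nu>) {1..sum_mset \<nu>} (SIGMA i:{1..size \<nu>}. {1..part \<nu> i})"
proof -
  have "bij_betw (\<lambda>k. k - 1) {1..sum_mset \<nu>} {..<length (cells \<nu>)}"
    by (rule bij_betw_byWitness[where f' = Suc]) (auto simp: length_cells)
  moreover have "bij_betw ((!) (cells \<nu>)) {..<length (cells \<nu>)} (set (cells \<nu>))"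
    by (rule bij_betw_nth) (auto simp: distinct_cells)
  ultimately show ?thesis
    unfolding cell_def set_cells[symmetric] by (rule bij_betw_trans[unfolded o_def])
qed

text \<open>Ordered pairs, so that each transposition is counted twice and the eigenvalue becomes
  \<open>kappa\<close> instead of \<open>kappa / 2\<close>.\<close>

definition offdiag :: "nat \<Rightarrow> (nat \<times> nat) set" where
  "offdiag d = {(x, y). x \<in> {1..d} \<and> y \<in> {1..d} \<and> x \<noteq> y}"

lemma finite_offdiag [simp]: "finite (offdiag d)"
  by (rule finite_subset[of _ "{1..d} \<times> {1..d}"]) (auto simp: offdiag_def)

text \<open>A cell in row \<open>i\<close> has \<open>part \<nu> i - 1\<close> others in its row.
  Column pairs are charged to their lower cell, which has \<open>i - 1\<close> cells above it, and
  each counts twice as an ordered pair. So every cell of row \<open>i\<close> accounts for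
  \<open>part \<nu> i - 2 * i + 1\<close>, the factor that \<open>kappa\<close> multiplies by the
  length of the row.\<close>

lemma sum_content_diagram:
  fixes \<nu> :: "nat multiset"
  defines "D \<equiv> SIGMA i:{1..size \<nu>}. {1..part \<nu> i}"
  shows "(\<Sum>u\<in>D. \<Sum>w\<in>D. of_bool (u \<noteq> w \<and> fst u = fst w) - of_bool (u \<noteq> w \<and> snd u = snd w)) = kappa \<nu>"
proof -
  have sum_of_bool: "(\<Sum>w\<in>D. of_bool (P w) :: int) = int (card {w \<in> D. P w})" for P
  proof -
    have "D \<inter> {w. P w} = {w \<in> D. P w}" by blast
    then show ?thesis using sum_of_bool_eq[of D P] by (simp add: D_def)
  qed
  let ?below = "\<lambda>u w. of_bool (snd u = snd w \<and> fst w < fst u) :: int"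
  have row: "(\<Sum>w\<in>D. of_bool (u \<noteq> w \<and> fst u = fst w)) = int (part \<nu> (fst u)) - 1" if u: "u \<in> D" for u
  proof -
    obtain i j where ij: "u = (i, j)" "1 \<le> i" "i \<le> size \<nu>" "1 \<le> j" "j \<le> part \<nu> i"
      using u by (auto simp: D_def)
    have "{w \<in> D. u \<noteq> w \<and> fst u = fst w} = Pair i ` ({1..part \<nu> i} - {j})"
      using ij by (auto simp: D_def)
    then have "card {w \<in> D. u \<noteq> w \<and> fst u = fst w} = card ({1..part \<nu> i} - {j})"
      by (simp add: card_image inj_on_def)
    also have "\<dots> = part \<nu> i - 1" using ij by simp
    finally show ?thesis using ij unfolding sum_of_bool by (simp add: of_nat_diff)
  qed
  have col: "(\<Sum>w\<in>D. ?below u w) = int (fst u) - 1" if u: "u \<in> D" for u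
  proof -
    obtain i j where ij: "u = (i, j)" "1 \<le> i" "i \<le> size \<nu>" "1 \<le> j" "j \<le> part \<nu> i"
      using u by (auto simp: D_def)
    have "{w \<in> D. snd u = snd w \<and> fst w < fst u} = (\<lambda>i. (i, j)) ` {1..<i}"
    proof (intro subset_antisym subsetI)
      fix w assume "w \<in> (\<lambda>i. (i, j)) ` {1..<i}"
      then obtain k where k: "w = (k, j)" "1 \<le> k" "k < i" by auto
      with ij have "part \<nu> i \<le> part \<nu> k" by (intro part_antimono) auto
      with ij k show "w \<in> {w \<in> D. snd u = snd w \<and> fst w < fst u}" by (auto simp: D_def)
    qed (use ij in \<open>auto simp: D_def\<close>)
    then have "card {w \<in> D. snd u = snd w \<and> fst w < fst u} = i - 1"
      by (simp add: card_image inj_on_def)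
    then show ?thesis using ij unfolding sum_of_bool by (simp add: of_nat_diff)
  qed
  \<comment> \<open>The number of all cells in a column would involve the conjugate partition.
    Splitting the relation into above and below and swapping the two sums needs only the cells
    above, whose number is known from the row index.\<close>
  have "(\<Sum>u\<in>D. \<Sum>w\<in>D. of_bool (u \<noteq> w \<and> snd u = snd w)) = (\<Sum>u\<in>D. \<Sum>w\<in>D. ?below u w + ?below w u)"
  proof (intro sum.cong refl)
    fix u w :: "nat \<times> nat"
    show "of_bool (u \<noteq> w \<and> snd u = snd w) = ?below u w + ?below w u"
      by (cases u; cases w) auto
  qed
  also have "\<dots> = (\<Sum>u\<in>D. \<Sum>w\<in>D. ?below u w) + (\<Sum>w\<in>D. \<Sum>u\<in>D. ?below u w)"
    by (simp add: sum.distrib)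
  also have "\<dots> = (\<Sum>u\<in>D. 2 * (int (fst u) - 1))"
    by (subst (2) sum.swap) (simp add: col sum_distrib_left)
  finally have "(\<Sum>u\<in>D. \<Sum>w\<in>D. of_bool (u \<noteq> w \<and> fst u = fst w) - of_bool (u \<noteq> w \<and> snd u = snd w))
      = (\<Sum>u\<in>D. int (part \<nu> (fst u)) - 1) - (\<Sum>u\<in>D. 2 * (int (fst u) - 1))"
    by (simp add: sum_subtractf row)
  also have "\<dots> = (\<Sum>u\<in>D. int (part \<nu> (fst u)) - 2 * int (fst u) + 1)"
    by (simp add: sum_subtractf[symmetric] algebra_simps)
  also have "\<dots> = (\<Sum>i=1..size \<nu>. \<Sum>j=1..part \<nu> i. int (part \<nu> i) - 2 * int i + 1)"
    unfolding D_def by (subst sum.Sigma) (auto simp: case_prod_beta)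
  also have "\<dots> = kappa \<nu>"
    by (simp add: kappa_def)
  finally show ?thesis .
qed

lemma sum_content:
  "(\<Sum>(x, y)\<in>offdiag (sum_mset \<nu>). of_bool (fst (cell \<nu> x) = fst (cell \<nu> y)) - of_bool (snd (cell \<nu> x) = snd (cell \<nu> y)))
    = kappa \<nu>" (is "(\<Sum>(x, y)\<in>_. ?f x y) = _")
proof -
  let ?A = "{1..sum_mset \<nu>}" and ?D = "SIGMA i:{1..size \<nu>}. {1..part \<nu> i}"
  let ?g = "\<lambda>u w. of_bool (u \<noteq> w \<and> fst u = fst w) - of_bool (u \<noteq> w \<and> snd u = snd w) :: int"
  have inj: "inj_on (cell \<nu>) ?A" using bij_betw_cell by (rule bij_betw_imp_inj_on)
  have "(\<Sum>(x, y)\<in>offdiag (sum_mset \<nu>). ?f x y) = (\<Sum>(x, y)\<in>?A \<times> ?A. ?g (cell \<nu> x) (cell \<nu> y))"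
    by (rule sum.mono_neutral_cong_left) (auto simp: offdiag_def dest: inj_onD[OF inj])
  also have "\<dots> = (\<Sum>x\<in>?A. \<Sum>y\<in>?A. ?g (cell \<nu> x) (cell \<nu> y))"
    by (simp add: sum.cartesian_product)
  also have "\<dots> = (\<Sum>x\<in>?A. \<Sum>w\<in>?D. ?g (cell \<nu> x) w)"
    by (intro sum.cong refl sum.reindex_bij_betw[OF bij_betw_cell])
  also have "\<dots> = (\<Sum>u\<in>?D. \<Sum>w\<in>?D. ?g u w)"
    by (rule sum.reindex_bij_betw[OF bij_betw_cell])
  also note sum_content_diagram
  finally show ?thesis .
qed

section \<open>Row and column groups, and the Young symmetrizer as an eigenvector\<close>

text \<open>The row group and the column group both consist of the permutations that preserve a
  labelling of the entries, by row or by column index. Closure and translation are proved once for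
  both.\<close>

definition fibre_group :: "nat \<Rightarrow> (nat \<Rightarrow> 'a) \<Rightarrow> (nat \<Rightarrow> nat) set" where
  "fibre_group d f = {\<sigma>. \<sigma> permutes {1..d} \<and> (\<forall>k\<in>{1..d}. f (\<sigma> k) = f k)}"

lemma row_group_eq: "row_group \<nu> = fibre_group (sum_mset \<nu>) (\<lambda>k. fst (cell \<nu> k))"
  and column_group_eq: "column_group \<nu> = fibre_group (sum_mset \<nu>) (\<lambda>k. snd (cell \<nu> k))"
  by (auto simp: row_group_def column_group_def fibre_group_def)

lemma finite_fibre_group [simp]: "finite (fibre_group d f)"
  by (rule finite_subset[OF _ finite_permutations[of "{1..d}"]]) (auto simp: fibre_group_def)

lemma fibre_group_permutes: "p \<in> fibre_group d f \<Longrightarrow> p permutes {1..d}"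
  by (simp add: fibre_group_def)

lemma fibre_group_comp: "p \<in> fibre_group d f \<Longrightarrow> q \<in> fibre_group d f \<Longrightarrow> p \<circ> q \<in> fibre_group d f"
  unfolding fibre_group_def
  by (simp add: permutes_compose del: atLeastAtMost_iff) (metis permutes_in_image)

lemma fibre_group_inv:
  assumes p: "p \<in> fibre_group d f"
  shows "inv p \<in> fibre_group d f"
proof -
  have "f (inv p k) = f k" if "k \<in> {1..d}" for k
  proof -
    have "inv p k \<in> {1..d}" using that permutes_in_image[OF permutes_inv[OF fibre_group_permutes[OF p]]] by blast
    then have "f (p (inv p k)) = f (inv p k)" using p unfolding fibre_group_def by blast
    then show ?thesis using permutes_inverses(1)[OF fibre_group_permutes[OF p]] by simp
  qed
  with p show ?thesis unfolding fibre_group_def by (simp add: permutes_inv del: atLeastAtMost_iff)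
qed

lemma transpose_in_fibre_group:
  "x \<in> {1..d} \<Longrightarrow> y \<in> {1..d} \<Longrightarrow> f x = f y \<Longrightarrow> transpose x y \<in> fibre_group d f"
  unfolding fibre_group_def by (simp add: permutes_swap_id transpose_def del: atLeastAtMost_iff)

lemma fibre_group_comp_iff:
  assumes p: "p \<in> fibre_group d f"
  shows "p \<circ> q \<in> fibre_group d f \<longleftrightarrow> q \<in> fibre_group d f"
proof
  assume "p \<circ> q \<in> fibre_group d f"
  then have "inv p \<circ> (p \<circ> q) \<in> fibre_group d f" using fibre_group_comp fibre_group_inv[OF p] by blast
  then show "q \<in> fibre_group d f"
    using permutes_inv_o(2)[OF fibre_group_permutes[OF p]] by (simp add: o_assoc)
qed (use p fibre_group_comp in blast)

lemma sum_fibre_group_translate: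
  assumes s: "s \<in> fibre_group d f"
  shows "(\<Sum>p\<in>fibre_group d f. h (s \<circ> p)) = (\<Sum>p\<in>fibre_group d f. h p)"
  using permutes_inv_o[OF fibre_group_permutes[OF s]] fibre_group_comp_iff[OF s] fibre_group_comp_iff[OF fibre_group_inv[OF s]]
  by (intro sum.reindex_bij_witness[of _ "\<lambda>p. inv s \<circ> p" "\<lambda>p. s \<circ> p"]) (simp_all add: o_assoc)

text \<open>The signed sum of the column group as an element of the group algebra, that is, the
  right factor of the Young symmetrizer.\<close>

definition signed_column :: "nat multiset \<Rightarrow> galg" where
  "signed_column \<nu> \<rho> = (if \<rho> \<in> column_group \<nu> then of_int (sign \<rho>) else 0)"

lemma signed_column_transpose:
  assumes "x \<in> {1..sum_mset \<nu>}" "y \<in> {1..sum_mset \<nu>}" "x \<noteq> y" "snd (cell \<nu> x) = snd (cell \<nu> y)"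
  shows "signed_column \<nu> (transpose x y \<circ> \<rho>) = - signed_column \<nu> \<rho>"
proof -
  have t: "transpose x y \<in> column_group \<nu>"
    using assms transpose_in_fibre_group by (metis column_group_eq)
  then have "transpose x y \<circ> \<rho> \<in> column_group \<nu> \<longleftrightarrow> \<rho> \<in> column_group \<nu>"
    by (simp add: column_group_eq fibre_group_comp_iff)
  moreover have "sign (transpose x y \<circ> \<rho>) = - sign \<rho>" if "\<rho> \<in> column_group \<nu>"
  proof -
    have "permutation \<rho>"
      using that permutation_permutes unfolding column_group_def by blast
    then show ?thesis using assms(3) by (simp add: sign_compose permutation_swap_id sign_swap_id)
  qed
  ultimately show ?thesis by (simp add: signed_column_def)
qed

text \<open>In \<open>p \<circ> q = \<sigma>\<close> the factor \<open>q\<close> is determined as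
  \<open>inv p \<circ> \<sigma>\<close>; then \<open>inv p\<close> is renamed to \<open>p\<close>,
  which is allowed because the row group is closed under inverses.\<close>

lemma young_symmetrizer_eq:
  "young_symmetrizer \<nu> \<sigma> = (\<Sum>p\<in>row_group \<nu>. signed_column \<nu> (p \<circ> \<sigma>))"
proof -
  have perm: "p permutes {1..sum_mset \<nu>}" if "p \<in> row_group \<nu>" for p
    using that by (simp add: row_group_def)
  have inv_row: "inv p \<in> row_group \<nu>" if "p \<in> row_group \<nu>" for p
    using that by (simp add: row_group_eq fibre_group_inv)
  have "young_symmetrizer \<nu> \<sigma> = (\<Sum>p\<in>{p \<in> row_group \<nu>. p \<circ> \<sigma> \<in> column_group \<nu>}. of_int (sign (p \<circ> \<sigma>)))"
    unfolding young_symmetrizer_def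
    by (rule sum.reindex_bij_witness[of _ "\<lambda>p. (inv p, p \<circ> \<sigma>)" "\<lambda>(p, q). inv p"])
      (auto simp: o_assoc permutes_inv_o[OF perm] permutes_inv_inv[OF perm] inv_row)
  also have "\<dots> = (\<Sum>p\<in>row_group \<nu>. signed_column \<nu> (p \<circ> \<sigma>))"
    by (subst sum.inter_filter) (auto simp: signed_column_def row_group_eq)
  finally show ?thesis .
qed

lemma comp_transpose: "inj f \<Longrightarrow> f \<circ> transpose x y = transpose (f x) (f y) \<circ> f"
  by (auto simp: fun_eq_iff transpose_def inj_eq)

text \<open>
  The cell in the row of \<open>x\<close> and the column of \<open>y\<close> lies in the diagram. With \<open>v\<close> its entry,
  \<open>(x y) (x v) = (y v) (x y)\<close>: translating the row group by \<open>(x v)\<close> changes the sum by the sign of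
  the column transposition \<open>(y v)\<close>.
\<close>

lemma young_symmetrizer_mixed_less:
  assumes x: "x \<in> {1..sum_mset \<nu>}" and y: "y \<in> {1..sum_mset \<nu>}"
    and r: "fst (cell \<nu> x) < fst (cell \<nu> y)" and c: "snd (cell \<nu> x) \<noteq> snd (cell \<nu> y)"
  shows "(\<Sum>p\<in>row_group \<nu>. signed_column \<nu> (transpose x y \<circ> (p \<circ> \<sigma>))) = 0"
proof -
  let ?D = "SIGMA i:{1..size \<nu>}. {1..part \<nu> i}"
  have "cell \<nu> x \<in> ?D" "cell \<nu> y \<in> ?D"
    using bij_betwE[OF bij_betw_cell] x y by blast+
  \<comment> \<open>By \<open>r\<close> the row of \<open>x\<close> lies above the row of
    \<open>y\<close> and is at least as long, so it reaches the column of \<open>y\<close>. The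
    opposite corner of the rectangle might lie outside the diagram.\<close>
  then have "(fst (cell \<nu> x), snd (cell \<nu> y)) \<in> ?D"
    using r part_antimono[of "fst (cell \<nu> x)" "fst (cell \<nu> y)" \<nu>] by (auto simp: mem_Times_iff case_prod_beta)
  then obtain v where v: "v \<in> {1..sum_mset \<nu>}" "cell \<nu> v = (fst (cell \<nu> x), snd (cell \<nu> y))"
    using bij_betw_imp_surj_on[OF bij_betw_cell[of \<nu>]] by (metis (no_types, lifting) imageE)
  have cv: "fst (cell \<nu> v) = fst (cell \<nu> x)" "snd (cell \<nu> v) = snd (cell \<nu> y)" using v(2) by simp_all
  have ne: "v \<noteq> x" "v \<noteq> y" "x \<noteq> y" using cv r c by auto
  have s: "transpose x v \<in> row_group \<nu>"
    unfolding row_group_eq using x v by (intro transpose_in_fibre_group) auto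
  have ts: "transpose x y \<circ> transpose x v = transpose y v \<circ> transpose x y"
    using ne by (subst comp_transpose) (auto simp: transpose_def)
  let ?S = "\<Sum>p\<in>row_group \<nu>. signed_column \<nu> (transpose x y \<circ> (p \<circ> \<sigma>))"
  have "?S = (\<Sum>p\<in>row_group \<nu>. signed_column \<nu> (transpose x y \<circ> (transpose x v \<circ> p \<circ> \<sigma>)))"
    using s unfolding row_group_eq by (intro sum_fibre_group_translate[symmetric])
  also have "\<dots> = (\<Sum>p\<in>row_group \<nu>. signed_column \<nu> (transpose y v \<circ> (transpose x y \<circ> (p \<circ> \<sigma>))))"
    by (intro sum.cong refl arg_cong[where f = "signed_column \<nu>"]) (simp add: o_assoc ts)
  also have "\<dots> = - ?S"
    using v y ne by (subst signed_column_transpose) (auto simp: sum_negf)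
  finally show ?thesis by simp
qed

text \<open>A transposition does not depend on the order of its two points, so the entry in the
  upper row can be taken as \<open>x\<close>.\<close>

lemma young_symmetrizer_mixed:
  assumes "x \<in> {1..sum_mset \<nu>}" "y \<in> {1..sum_mset \<nu>}"
    and "fst (cell \<nu> x) \<noteq> fst (cell \<nu> y)" "snd (cell \<nu> x) \<noteq> snd (cell \<nu> y)"
  shows "(\<Sum>p\<in>row_group \<nu>. signed_column \<nu> (transpose x y \<circ> (p \<circ> \<sigma>))) = 0"
  using assms young_symmetrizer_mixed_less[of x \<nu> y \<sigma>] young_symmetrizer_mixed_less[of y \<nu> x \<sigma>]
  by (metis nat_neq_iff transpose_commute)

text \<open>Together with \<open>comp_transpose\<close> this is the centrality of the sum of all
  transpositions.\<close>

lemma sum_offdiag_permutes: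
  assumes p: "p permutes {1..d}"
  shows "(\<Sum>(x, y)\<in>offdiag d. h (p x) (p y)) = (\<Sum>(x, y)\<in>offdiag d. h x y)"
  using permutes_in_image[OF p] permutes_in_image[OF permutes_inv[OF p]] permutes_inverses[OF p]
    inj_eq[OF permutes_inj[OF p]] inj_eq[OF permutes_inj[OF permutes_inv[OF p]]]
  by (intro sum.reindex_bij_witness[of _ "\<lambda>(x, y). (inv p x, inv p y)" "\<lambda>(x, y). (p x, p y)"])
    (auto simp: offdiag_def)

text \<open>Centrality moves the transposition to the left of the row permutation. For a fixed pair
  it is then absorbed by translating the row group (same row), yields a sign (same column), or makes
  the sum vanish (neither). Adding up these values gives \<open>sum_content\<close>.\<close>

lemma young_symmetrizer_transposition_sum:
  "(\<Sum>(x, y)\<in>offdiag (sum_mset \<nu>). young_symmetrizer \<nu> (transpose x y \<circ> \<sigma>))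
    = of_int (kappa \<nu>) * young_symmetrizer \<nu> \<sigma>"
proof -
  let ?P = "offdiag (sum_mset \<nu>)" and ?e = "young_symmetrizer \<nu> \<sigma>"
  have "(\<Sum>(x, y)\<in>?P. young_symmetrizer \<nu> (transpose x y \<circ> \<sigma>))
      = (\<Sum>p\<in>row_group \<nu>. \<Sum>(x, y)\<in>?P. signed_column \<nu> (p \<circ> (transpose x y \<circ> \<sigma>)))"
    unfolding young_symmetrizer_eq by (subst sum.swap) (simp add: case_prod_unfold)
  also have "\<dots> = (\<Sum>p\<in>row_group \<nu>. \<Sum>(x, y)\<in>?P. signed_column \<nu> (transpose x y \<circ> (p \<circ> \<sigma>)))"
  proof (rule sum.cong[OF refl])
    fix p assume "p \<in> row_group \<nu>"
    then have p: "p permutes {1..sum_mset \<nu>}" by (simp add: row_group_def)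
    have "p \<circ> (transpose x y \<circ> \<sigma>) = transpose (p x) (p y) \<circ> (p \<circ> \<sigma>)" for x y
      by (simp add: o_assoc comp_transpose[OF permutes_inj[OF p]])
    then show "(\<Sum>(x, y)\<in>?P. signed_column \<nu> (p \<circ> (transpose x y \<circ> \<sigma>)))
        = (\<Sum>(x, y)\<in>?P. signed_column \<nu> (transpose x y \<circ> (p \<circ> \<sigma>)))"
      using sum_offdiag_permutes[OF p, of "\<lambda>x y. signed_column \<nu> (transpose x y \<circ> (p \<circ> \<sigma>))"] by simp
  qed
  also have "\<dots> = (\<Sum>(x, y)\<in>?P. \<Sum>p\<in>row_group \<nu>. signed_column \<nu> (transpose x y \<circ> (p \<circ> \<sigma>)))"
    by (subst sum.swap) (simp add: case_prod_unfold)
  also have "\<dots> = (\<Sum>(x, y)\<in>?P. of_int (of_bool (fst (cell \<nu> x) = fst (cell \<nu> y))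
      - of_bool (snd (cell \<nu> x) = snd (cell \<nu> y))) * ?e)"
  proof (rule sum.cong[OF refl], clarify)
    fix x y assume "(x, y) \<in> ?P"
    then have xy: "x \<in> {1..sum_mset \<nu>}" "y \<in> {1..sum_mset \<nu>}" "x \<noteq> y" by (auto simp: offdiag_def)
    let ?S = "\<Sum>p\<in>row_group \<nu>. signed_column \<nu> (transpose x y \<circ> (p \<circ> \<sigma>))"
    have ne: "fst (cell \<nu> x) \<noteq> fst (cell \<nu> y) \<or> snd (cell \<nu> x) \<noteq> snd (cell \<nu> y)"
      using xy bij_betw_imp_inj_on[OF bij_betw_cell] by (metis inj_onD prod_eqI)
    have row: "?S = ?e" if "fst (cell \<nu> x) = fst (cell \<nu> y)"
    proof -
      have "transpose x y \<in> row_group \<nu>"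
        unfolding row_group_eq using xy that by (intro transpose_in_fibre_group)
      then have "(\<Sum>p\<in>row_group \<nu>. signed_column \<nu> (transpose x y \<circ> p \<circ> \<sigma>)) = ?e"
        unfolding row_group_eq young_symmetrizer_eq by (rule sum_fibre_group_translate)
      then show ?thesis by (simp add: o_assoc)
    qed
    have col: "?S = - ?e" if "snd (cell \<nu> x) = snd (cell \<nu> y)"
      using xy that by (simp add: signed_column_transpose sum_negf young_symmetrizer_eq)
    show "?S = of_int (of_bool (fst (cell \<nu> x) = fst (cell \<nu> y)) - of_bool (snd (cell \<nu> x) = snd (cell \<nu> y))) * ?e"
      using ne row col young_symmetrizer_mixed[OF xy(1,2)] by (auto simp: of_bool_def)
  qed
  also have "\<dots> = of_int (kappa \<nu>) * ?e"
    unfolding sum_content[symmetric] by (simp add: sum_distrib_right case_prod_unfold)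
  finally show ?thesis .
qed

lemma sum_fun_apply: "(\<Sum>i\<in>I. f i) x = (\<Sum>i\<in>I. f i x)"
  for f :: "'i \<Rightarrow> 'a \<Rightarrow> 'b::comm_monoid_add"
  by (induction I rule: infinite_finite_induct) auto

text \<open>On a generator \<open>left_mult h (young_symmetrizer \<nu>)\<close>, moving the
  transpositions past \<open>inv h\<close> only permutes the pairs, so the identity for the
  symmetrizer applies; it extends to the span by linearity.\<close>

lemma specht_transposition_sum:
  assumes w: "w \<in> specht \<nu>"
  shows "(\<Sum>(x, y)\<in>offdiag (sum_mset \<nu>). left_mult (transpose x y) w) = galg_scale (of_int (kappa \<nu>)) w"
  using w unfolding specht_def
proof (induction rule: galg.span_induct_alt)
  case base
  show ?case by (simp add: left_mult_def galg_scale_def fun_eq_iff sum_fun_apply case_prod_unfold)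
next
  case (step c u v)
  then obtain h where h: "h permutes {1..sum_mset \<nu>}" and u: "u = left_mult h (young_symmetrizer \<nu>)"
    by blast
  let ?P = "offdiag (sum_mset \<nu>)" and ?k = "of_int (kappa \<nu>) :: complex"
  have inj: "inj (inv h)" using h by (intro permutes_inj permutes_inv)
  have u_sum: "(\<Sum>(x, y)\<in>?P. left_mult (transpose x y) u \<sigma>) = ?k * u \<sigma>" for \<sigma>
  proof -
    have "(\<Sum>(x, y)\<in>?P. left_mult (transpose x y) u \<sigma>)
        = (\<Sum>(x, y)\<in>?P. young_symmetrizer \<nu> (transpose (inv h x) (inv h y) \<circ> (inv h \<circ> \<sigma>)))"
      by (simp add: left_mult_def u o_assoc comp_transpose[OF inj])
    also have "\<dots> = (\<Sum>(x, y)\<in>?P. young_symmetrizer \<nu> (transpose x y \<circ> (inv h \<circ> \<sigma>)))"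
      by (rule sum_offdiag_permutes[OF permutes_inv[OF h]])
    also have "\<dots> = ?k * u \<sigma>"
      by (simp only: young_symmetrizer_transposition_sum) (simp add: u left_mult_def)
    finally show ?thesis .
  qed
  show ?case
  proof
    fix \<sigma>
    have lin: "left_mult t (galg_scale c u + v) \<sigma> = c * left_mult t u \<sigma> + left_mult t v \<sigma>" for t
      by (simp add: left_mult_def galg_scale_def)
    have "(\<Sum>(x, y)\<in>?P. left_mult (transpose x y) v \<sigma>) = ?k * v \<sigma>"
      using fun_cong[OF step.IH, of \<sigma>] by (simp add: sum_fun_apply case_prod_unfold galg_scale_def)
    with u_sum show "(\<Sum>(x, y)\<in>?P. left_mult (transpose x y) (galg_scale c u + v)) \<sigma> =
        galg_scale ?k (galg_scale c u + v) \<sigma>"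
      by (simp add: sum_fun_apply case_prod_unfold lin sum.distrib sum_distrib_left[symmetric])
        (simp add: galg_scale_def algebra_simps)
  qed
qed

lemma irr_char_transposition_sum:
  assumes g: "g permutes {1..sum_mset \<nu>}"
  shows "(\<Sum>(x, y)\<in>offdiag (sum_mset \<nu>). irr_char \<nu> (transpose x y \<circ> g)) = of_int (kappa \<nu>) * irr_char \<nu> g"
proof -
  let ?P = "offdiag (sum_mset \<nu>)"
  let ?X = "(\<lambda>g. left_mult g (young_symmetrizer \<nu>)) ` {g. g permutes {1..sum_mset \<nu>}}"
  have X: "finite ?X" by (intro finite_imageI finite_permutations) simp
  have inv: "left_mult (transpose (fst z) (snd z) \<circ> g) w \<in> specht \<nu>" if "z \<in> ?P" "w \<in> specht \<nu>" for z w
    using that g by (intro specht_invariant permutes_compose[OF g] permutes_swap_id) (auto simp: offdiag_def)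
  have "(\<Sum>(x, y)\<in>?P. irr_char \<nu> (transpose x y \<circ> g))
      = trace_on (specht \<nu>) (\<lambda>w. \<Sum>z\<in>?P. left_mult (transpose (fst z) (snd z) \<circ> g) w)"
    unfolding irr_char_def using inv by (subst trace_on_sum[OF X specht_def]) (auto simp: case_prod_unfold)
  also have "\<dots> = trace_on (specht \<nu>) (\<lambda>w. galg_scale (of_int (kappa \<nu>)) (left_mult g w))"
  proof (rule trace_on_cong[OF X specht_def])
    fix w assume w: "w \<in> specht \<nu>"
    have "(\<Sum>z\<in>?P. left_mult (transpose (fst z) (snd z) \<circ> g) w)
        = (\<Sum>(x, y)\<in>?P. left_mult (transpose x y) (left_mult g w))"
      using g by (simp add: left_mult_comp permutes_bij case_prod_unfold)
    also note specht_transposition_sum[OF specht_invariant[OF g w]]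
    finally show "(\<Sum>z\<in>?P. left_mult (transpose (fst z) (snd z) \<circ> g) w)
        = galg_scale (of_int (kappa \<nu>)) (left_mult g w)" .
  qed
  also have "\<dots> = of_int (kappa \<nu>) * irr_char \<nu> g"
    unfolding irr_char_def using specht_invariant[OF g] by (intro trace_on_scale[OF X specht_def])
  finally show ?thesis .
qed

section \<open>Cycle types and transpositions\<close>

text \<open>The size of the cycle is the first return time \<open>funpow_dist1 g x x\<close>, hence
  the smaller powers enumerate the cycle without repetition.\<close>

lemma orbit_card:
  assumes g: "permutation g"
  defines "n \<equiv> \<lambda>x. card (orbit g x)"
  shows "0 < n x" and "(g ^^ n x) x = x" and "inj_on (\<lambda>k. (g ^^ k) x) {..<n x}"
    and "orbit g x = (\<lambda>k. (g ^^ k) x) ` {..<n x}"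
proof -
  have x: "x \<in> orbit g x" by (rule permutation_self_in_orbit[OF g])
  have n: "n x = funpow_dist1 g x x"
    unfolding n_def by (subst orbit_conv_funpow_dist1[OF x]) (simp add: card_image inj_on_funpow_dist1[OF x] del: funpow.simps)
  show "0 < n x" by (simp add: n)
  show "(g ^^ n x) x = x" unfolding n by (rule funpow_dist1_prop[OF x])
  show "inj_on (\<lambda>k. (g ^^ k) x) {..<n x}"
    using inj_on_funpow_dist1[OF x] by (simp only: n lessThan_atLeast0)
  show "orbit g x = (\<lambda>k. (g ^^ k) x) ` {..<n x}"
    using orbit_conv_funpow_dist1[OF x] by (simp only: n lessThan_atLeast0)
qed

lemma funpow_eq_orbit:
  assumes g: "permutation g"
  shows "(g ^^ k) x = (g ^^ l) x \<longleftrightarrow> k mod card (orbit g x) = l mod card (orbit g x)"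
proof -
  note o = orbit_card[OF g, of x]
  have "(g ^^ k) x = (g ^^ (k mod card (orbit g x))) x" for k
    using funpow_mod_eq[OF o(2)] by simp
  then have "(g ^^ k) x = (g ^^ l) x \<longleftrightarrow> (g ^^ (k mod card (orbit g x))) x = (g ^^ (l mod card (orbit g x))) x"
    by metis
  also have "\<dots> \<longleftrightarrow> k mod card (orbit g x) = l mod card (orbit g x)"
    using o(1) inj_on_eq_iff[OF o(3)] by simp
  finally show ?thesis .
qed

lemma orbit_eq_iff: "permutation g \<Longrightarrow> orbit g x = orbit g y \<longleftrightarrow> y \<in> orbit g x"
  by (metis cyclic_on_orbit' orbit_cyclic_eq3 permutation_self_in_orbit)

text \<open>Before step \<open>i\<close> the \<open>g\<close>-path from \<open>x\<close> meets
  neither of the two transposed points again, so the new permutation follows it; step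
  \<open>i\<close> would reach \<open>(g ^^ i) x\<close> and is redirected to
  \<open>x\<close>.\<close>

lemma orbit_cut_first:
  assumes g: "permutation g" and i: "0 < i" "i < card (orbit g x)"
  shows "orbit (transpose x ((g ^^ i) x) \<circ> g) x = (\<lambda>k. (g ^^ k) x) ` {..<i}"
proof -
  let ?h = "transpose x ((g ^^ i) x) \<circ> g"
  have "(?h ^^ k) x = (g ^^ k) x" if "k < i" for k
    using that
  proof (induction k)
    case (Suc k)
    then have "(g ^^ Suc k) x \<noteq> (g ^^ 0) x" "(g ^^ Suc k) x \<noteq> (g ^^ i) x"
      unfolding funpow_eq_orbit[OF g] using i by auto
    then show ?case using Suc by (simp add: transpose_apply_other)
  qed simp
  note pow = this
  have Si: "Suc (i - 1) = i" using i by simp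
  have "(?h ^^ Suc (i - 1)) x = ?h ((g ^^ (i - 1)) x)"
    using pow[of "i - 1"] i by (simp only: funpow.simps o_apply)
  also have "\<dots> = transpose x ((g ^^ i) x) ((g ^^ Suc (i - 1)) x)" by simp
  also have "\<dots> = x" unfolding Si by simp
  finally have "(?h ^^ i) x = x" unfolding Si .
  from orbit_altdef_bounded[OF this i(1)] show ?thesis using pow by force
qed

text \<open>The two halves are symmetric: from \<open>(g ^^ i) x\<close> the point \<open>x\<close>
  is reached after the remaining \<open>card (orbit g x) - i\<close> steps, so
  \<open>orbit_cut_first\<close> describes the second half as well.\<close>

lemma orbit_cut:
  assumes g: "permutation g" and i: "0 < i" "i < card (orbit g x)"
  defines "h \<equiv> transpose x ((g ^^ i) x) \<circ> g"
  shows "card (orbit h x) = i" and "card (orbit h ((g ^^ i) x)) = card (orbit g x) - i"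
    and "orbit h x \<union> orbit h ((g ^^ i) x) = orbit g x" and "(g ^^ i) x \<notin> orbit h x"
proof -
  let ?n = "card (orbit g x)" and ?y = "(g ^^ i) x"
  note o = orbit_card[OF g, of x]
  have yx: "orbit g ?y = orbit g x"
    using orbit_eq_iff[OF g, of x ?y] funpow_in_orbit[OF permutation_self_in_orbit[OF g], of i x] by simp
  have ret: "(g ^^ (?n - i)) ?y = x"
  proof -
    have "(g ^^ (?n - i)) ?y = (g ^^ (?n - i + i)) x" by (simp only: funpow_add o_apply)
    also have "\<dots> = x" using i o(2) by simp
    finally show ?thesis .
  qed
  have A: "orbit h x = (\<lambda>k. (g ^^ k) x) ` {..<i}"
    unfolding h_def by (rule orbit_cut_first[OF g i])
  have B: "orbit h ?y = (\<lambda>k. (g ^^ k) ?y) ` {..<?n - i}"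
    using orbit_cut_first[OF g, of "?n - i" ?y, unfolded ret yx] i
    unfolding h_def transpose_commute[of x] by simp
  also have "\<dots> = (\<lambda>k. (g ^^ k) x) ` (\<lambda>k. k + i) ` {..<?n - i}"
    by (simp only: image_image funpow_add o_apply)
  also have "(\<lambda>k. k + i) ` {..<?n - i} = {i..<?n}"
    unfolding lessThan_atLeast0 image_add_atLeastLessThan' using i by simp
  finally have B: "orbit h ?y = (\<lambda>k. (g ^^ k) x) ` {i..<?n}" .
  show "card (orbit h x) = i"
    unfolding A using o(3) i by (subst card_image) (auto intro: inj_on_subset[OF o(3)])
  show "card (orbit h ?y) = ?n - i"
    unfolding B using o(3) i by (subst card_image) (auto intro: inj_on_subset[OF o(3)])
  have "{..<i} \<union> {i..<?n} = {..<?n}" using i by auto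
  then show "orbit h x \<union> orbit h ?y = orbit g x"
    unfolding A B image_Un[symmetric] by (simp only: o(4)[symmetric])
  have "?y \<noteq> (g ^^ k) x" if "k < i" for k
    unfolding funpow_eq_orbit[OF g] using that i by simp
  then show "?y \<notin> orbit h x" unfolding A by blast
qed

lemma orbit_transpose_other:
  assumes g: "permutation g" and z: "x \<notin> orbit g z" "y \<notin> orbit g z"
  shows "orbit (transpose x y \<circ> g) z = orbit g z"
proof (rule orbit_cong)
  show "z \<in> orbit g z" by (rule permutation_self_in_orbit[OF g])
  show "(transpose x y \<circ> g) s = g s" if "s \<in> orbit g z" for s
    using that z orbit.step[OF that] by (metis comp_apply transpose_apply_other)
qed

text \<open>\<open>M\<close> collects the lengths of the untouched cycles. Because it is shared by
  both cycle types, the relation between them can be read forwards for cutting and backwards for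
  joining.\<close>

lemma cycle_type_cut_aux:
  assumes g: "g permutes {1..d}" and x: "x \<in> {1..d}" and i: "0 < i" "i < card (orbit g x)"
  defines "h \<equiv> transpose x ((g ^^ i) x) \<circ> g"
  defines "M \<equiv> image_mset card (mset_set (orbit g ` ({1..d} - orbit g x)))"
  shows "cycle_type d g = add_mset (card (orbit g x)) M"
    and "cycle_type d h = add_mset i (add_mset (card (orbit g x) - i) M)"
proof -
  let ?y = "(g ^^ i) x" and ?r = "{1..d} - orbit g x"
  have p: "permutation g" using g permutation_permutes by blast
  note self = permutation_self_in_orbit[OF p]
  have y: "?y \<in> orbit g x" by (rule funpow_in_orbit[OF self])
  have sub: "orbit g x \<subseteq> {1..d}" by (rule permutes_orbit_subset[OF g x])
  with y have y': "?y \<in> {1..d}" by blast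
  have "h permutes {1..d}"
    unfolding h_def using g x y' by (intro permutes_compose permutes_swap_id)
  then have ph: "permutation h" using permutation_permutes by blast
  note cut = orbit_cut[OF p i, folded h_def]
  have split: "{1..d} = insert x (orbit g x) \<union> ?r" using sub x by blast
  have "orbit g ` {1..d} = insert (orbit g x) (orbit g ` ?r)"
    unfolding split[THEN arg_cong[where f = "image (orbit g)"]] using orbit_eq_iff[OF p] by auto
  moreover have g_notin: "orbit g x \<notin> orbit g ` ?r"
    using orbit_eq_iff[OF p] by blast
  ultimately show "cycle_type d g = add_mset (card (orbit g x)) M"
    by (simp add: cycle_type_def M_def)
  have other: "orbit h z = orbit g z" if "z \<in> ?r" for z
  proof -
    have "orbit g z \<noteq> orbit g x" using that orbit_eq_iff[OF p] by blast
    then show ?thesis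
      unfolding h_def using y orbit_eq_iff[OF p] by (intro orbit_transpose_other[OF p]) metis+
  qed
  have in_h: "orbit h z = orbit h x \<or> orbit h z = orbit h ?y" if "z \<in> orbit g x" for z
    using that cut(3) orbit_eq_iff[OF ph] by blast
  have "orbit h ` {1..d} = orbit h ` insert x (orbit g x) \<union> orbit h ` ?r"
    by (subst split) (rule image_Un)
  also have "orbit h ` insert x (orbit g x) = {orbit h x, orbit h ?y}"
    using in_h y by blast
  also have "orbit h ` ?r = orbit g ` ?r"
    using other by (rule image_cong[OF refl])
  finally have "orbit h ` {1..d} = insert (orbit h x) (insert (orbit h ?y) (orbit g ` ?r))" by simp
  moreover have "orbit h x \<noteq> orbit h ?y"
    using cut(4) orbit_eq_iff[OF ph] by blast
  moreover have "A \<notin> orbit g ` ?r" if "A \<subseteq> orbit g x" for A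
    using that self by blast
  then have "orbit h x \<notin> orbit g ` ?r" "orbit h ?y \<notin> orbit g ` ?r"
    using cut(3) by blast+
  ultimately show "cycle_type d h = add_mset i (add_mset (card (orbit g x) - i) M)"
    using cut(1,2) by (simp add: cycle_type_def M_def)
qed

lemma cycle_type_cut:
  assumes "g permutes {1..d}" "x \<in> {1..d}" "0 < i" "i < card (orbit g x)"
  shows "cycle_type d (transpose x ((g ^^ i) x) \<circ> g)
    = add_mset i (add_mset (card (orbit g x) - i) (cycle_type d g - {#card (orbit g x)#}))"
  using cycle_type_cut_aux[OF assms] by simp

text \<open>Joining undoes a cut: \<open>g = (x y) h\<close> cuts the cycle of \<open>h = (x y) g\<close> that contains \<open>x\<close> and \<open>y\<close>.\<close>

lemma cycle_type_join:
  assumes g: "g permutes {1..d}" and x: "x \<in> {1..d}" and y: "y \<in> {1..d}" "y \<notin> orbit g x"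
  shows "cycle_type d (transpose x y \<circ> g) = add_mset (card (orbit g x) + card (orbit g y))
      (cycle_type d g - {#card (orbit g x), card (orbit g y)#})"
proof -
  let ?t = "transpose x y" and ?n = "card (orbit g x)"
  define h where "h = ?t \<circ> g"
  have p: "permutation g" using g permutation_permutes by blast
  have hp: "h permutes {1..d}"
    unfolding h_def using g x y by (intro permutes_compose permutes_swap_id)
  then have ph: "permutation h" using permutation_permutes by blast
  have g_eq: "g = ?t \<circ> h" by (simp add: h_def o_assoc)
  note o = orbit_card[OF p, of x]
  have pow: "(h ^^ k) x = (g ^^ k) x" if "k < ?n" for k
    using that
  proof (induction k)
    case (Suc k)
    then have "(g ^^ Suc k) x \<noteq> (g ^^ 0) x" unfolding funpow_eq_orbit[OF p] by auto
    moreover have "(g ^^ Suc k) x \<noteq> y"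
      using y funpow_in_orbit[OF permutation_self_in_orbit[OF p]] by metis
    ultimately show ?case using Suc by (simp add: h_def transpose_apply_other)
  qed simp
  \<comment> \<open>The step that would close the \<open>g\<close>-cycle at \<open>x\<close> lands
    on \<open>y\<close>, so \<open>y\<close> lies on the \<open>h\<close>-cycle of
    \<open>x\<close>.\<close>
  have "(h ^^ ?n) x = (h ^^ Suc (?n - 1)) x" using o(1) by simp
  also have "\<dots> = h ((g ^^ (?n - 1)) x)" using pow[of "?n - 1"] o(1) by (simp only: funpow.simps o_apply)
  also have "\<dots> = ?t ((g ^^ Suc (?n - 1)) x)" by (simp add: h_def)
  also have "\<dots> = y" using o(1,2) by simp
  finally have hn: "(h ^^ ?n) x = y" .
  have xy: "x \<noteq> y" using y permutation_self_in_orbit[OF p] by blast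
  let ?N = "card (orbit h x)"
  \<comment> \<open>\<open>orbit_cut\<close> wants an exponent below the length of the
    \<open>h\<close>-cycle, which is not known at this point; hence the reduction. Afterwards
    \<open>cut(1)\<close> yields \<open>i = ?n\<close>.\<close>
  define i where "i = ?n mod ?N"
  have hi: "(h ^^ i) x = y"
    using hn funpow_mod_eq[OF orbit_card(2)[OF ph]] by (simp add: i_def)
  have "i \<noteq> 0" using hi xy by (intro notI) simp
  then have i: "0 < i" "i < ?N" using orbit_card(1)[OF ph] by (auto simp: i_def)
  note cut = orbit_cut[OF ph i, unfolded hi, folded g_eq]
  note ct = cycle_type_cut_aux[OF hp x i, unfolded hi, folded g_eq]
  obtain M where M: "cycle_type d h = add_mset ?N M" "cycle_type d g = add_mset i (add_mset (?N - i) M)"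
    using ct by blast
  show ?thesis
    unfolding h_def[symmetric] M cut(1,2) using i by simp
qed

text \<open>A cycle of length \<open>n\<close> is met once from each of its \<open>n\<close>
  points.\<close>

lemma sum_orbit_card:
  fixes F :: "nat \<Rightarrow> 'a::comm_semiring_1"
  assumes g: "g permutes {1..d}"
  shows "(\<Sum>x\<in>{1..d}. F (card (orbit g x))) = (\<Sum>n\<in>#cycle_type d g. of_nat n * F n)"
proof -
  have p: "permutation g" using g permutation_permutes by blast
  have "(\<Sum>x\<in>{1..d}. F (card (orbit g x)))
      = (\<Sum>K\<in>orbit g ` {1..d}. \<Sum>x\<in>{x. x \<in> {1..d} \<and> orbit g x = K}. F (card (orbit g x)))"
    by (rule sum.image_gen) simp
  also have "\<dots> = (\<Sum>K\<in>orbit g ` {1..d}. of_nat (card K) * F (card K))"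
  proof (rule sum.cong[OF refl])
    fix K assume "K \<in> orbit g ` {1..d}"
    then obtain z where z: "z \<in> {1..d}" "K = orbit g z" by blast
    then have K: "{x. x \<in> {1..d} \<and> orbit g x = K} = K"
      using orbit_eq_iff[OF p] permutes_orbit_subset[OF g z(1)] by blast
    have "card (orbit g x) = card K" if "x \<in> K" for x
      using that z(2) orbit_eq_iff[OF p, of z x] by simp
    then have "(\<Sum>x\<in>K. F (card (orbit g x))) = (\<Sum>x\<in>K. F (card K))"
      by (intro sum.cong refl arg_cong[where f = F])
    then show "(\<Sum>x\<in>{x. x \<in> {1..d} \<and> orbit g x = K}. F (card (orbit g x))) = of_nat (card K) * F (card K)"
      unfolding K by simp
  qed
  also have "\<dots> = (\<Sum>n\<in>#cycle_type d g. of_nat n * F n)"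
    by (simp add: cycle_type_def image_mset.compositionality o_def sum_unfold_sum_mset)
  finally show ?thesis .
qed

lemma card_orbit_in_cycle_type:
  "x \<in> {1..d} \<Longrightarrow> card (orbit g x) \<in># cycle_type d g"
  by (auto simp: cycle_type_def)

lemma sum_mset_remove1:
  fixes F :: "'a \<Rightarrow> 'b::comm_ring_1"
  shows "a \<in># M \<Longrightarrow> (\<Sum>n\<in>#M - {#a#}. F n) = (\<Sum>n\<in>#M. F n) - F a"
  by (auto dest!: multi_member_split)

text \<open>Fix \<open>x\<close> on a cycle of length \<open>n\<close>. The other points of its
  cycle are \<open>(g ^^ i) x\<close> with \<open>0 < i < n\<close>, and each cuts the cycle into
  \<open>i\<close> and \<open>n - i\<close>. A point on another cycle, of length \<open>m\<close>,
  joins the two, and that cycle offers \<open>m\<close> such points. Summing over \<open>x\<close>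
  produces the factor \<open>n\<close>.\<close>

lemma transposition_sum_cycle_type:
  fixes \<phi> :: "nat multiset \<Rightarrow> 'a::comm_ring_1"
  assumes g: "g permutes {1..d}"
  defines "\<mu> \<equiv> cycle_type d g"
  shows "(\<Sum>(x, y)\<in>offdiag d. \<phi> (cycle_type d (transpose x y \<circ> g)))
    = (\<Sum>n\<in>#\<mu>. of_nat n * (\<Sum>i\<in>{1..<n}. \<phi> (add_mset i (add_mset (n - i) (\<mu> - {#n#})))))
    + (\<Sum>n\<in>#\<mu>. of_nat n * (\<Sum>m\<in>#\<mu> - {#n#}. of_nat m * \<phi> (add_mset (n + m) (\<mu> - {#n, m#}))))"
proof -
  have p: "permutation g" using g permutation_permutes by blast
  note self = permutation_self_in_orbit[OF p]
  let ?f = "\<lambda>x y. \<phi> (cycle_type d (transpose x y \<circ> g))"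
  let ?C = "\<lambda>n. \<Sum>i\<in>{1..<n}. \<phi> (add_mset i (add_mset (n - i) (\<mu> - {#n#})))"
  let ?J = "\<lambda>n. \<Sum>m\<in>#\<mu> - {#n#}. of_nat m * \<phi> (add_mset (n + m) (\<mu> - {#n, m#}))"
  have "(\<Sum>(x, y)\<in>offdiag d. ?f x y) = (\<Sum>x\<in>{1..d}. \<Sum>y\<in>{1..d} - {x}. ?f x y)"
  proof (subst sum.Sigma)
    have "offdiag d = Sigma {1..d} (\<lambda>x. {1..d} - {x})" by (auto simp: offdiag_def)
    then show "(\<Sum>(x, y)\<in>offdiag d. ?f x y) = (\<Sum>(x, y)\<in>Sigma {1..d} (\<lambda>x. {1..d} - {x}). ?f x y)"
      by (rule sum.cong) (rule refl)
  qed simp_all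
  also have "\<dots> = (\<Sum>x\<in>{1..d}. ?C (card (orbit g x)) + ?J (card (orbit g x)))"
  proof (rule sum.cong[OF refl])
    fix x assume x: "x \<in> {1..d}"
    let ?O = "orbit g x" and ?n = "card (orbit g x)"
    note o = orbit_card[OF p, of x]
    have sub: "?O \<subseteq> {1..d}" by (rule permutes_orbit_subset[OF g x])
    then have finO: "finite ?O" by (rule finite_subset) simp
    have "{1..d} - {x} = (?O - {x}) \<union> ({1..d} - ?O)" using sub self[of x] by blast
    then have "(\<Sum>y\<in>{1..d} - {x}. ?f x y) = (\<Sum>y\<in>?O - {x}. ?f x y) + (\<Sum>y\<in>{1..d} - ?O. ?f x y)"
      using finO by (simp only:) (rule sum.union_disjoint; blast)
    also have "(\<Sum>y\<in>?O - {x}. ?f x y) = (\<Sum>i\<in>{1..<?n}. ?f x ((g ^^ i) x))"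
    proof -
      have "{..<?n} = insert 0 {1..<?n}" using o(1) by auto
      then have "(\<lambda>k. (g ^^ k) x) ` {..<?n} = insert x ((\<lambda>k. (g ^^ k) x) ` {1..<?n})" by simp
      then have "?O = insert x ((\<lambda>k. (g ^^ k) x) ` {1..<?n})" unfolding o(4)[symmetric] .
      moreover have "x \<notin> (\<lambda>k. (g ^^ k) x) ` {1..<?n}"
        using funpow_eq_orbit[OF p, of 0 x] by auto
      ultimately have "?O - {x} = (\<lambda>k. (g ^^ k) x) ` {1..<?n}" by blast
      moreover have "inj_on (\<lambda>k. (g ^^ k) x) {1..<?n}"
        by (rule inj_on_subset[OF o(3)]) auto
      ultimately show ?thesis by (simp add: sum.reindex)
    qed
    also have "\<dots> = ?C ?n"
      unfolding \<mu>_def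
    proof (rule sum.cong[OF refl])
      fix i assume "i \<in> {1..<?n}"
      then have "0 < i" "i < ?n" by simp_all
      from cycle_type_cut[OF g x this]
      show "?f x ((g ^^ i) x) = \<phi> (add_mset i (add_mset (?n - i) (cycle_type d g - {#?n#})))"
        by (rule arg_cong)
    qed
    also have "(\<Sum>y\<in>{1..d} - ?O. ?f x y)
        = (\<Sum>y\<in>{1..d} - ?O. \<phi> (add_mset (?n + card (orbit g y)) (\<mu> - {#?n, card (orbit g y)#})))"
      unfolding \<mu>_def
    proof (rule sum.cong[OF refl])
      fix y assume "y \<in> {1..d} - ?O"
      then have "y \<in> {1..d}" "y \<notin> ?O" by simp_all
      from cycle_type_join[OF g x this]
      show "?f x y = \<phi> (add_mset (?n + card (orbit g y)) (cycle_type d g - {#?n, card (orbit g y)#}))"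
        by (rule arg_cong)
    qed
    also have "\<dots> = ?J ?n"
    proof -
      \<comment> \<open>The points off the cycle of \<open>x\<close> are counted as all points minus
        those on it; this removes one copy of \<open>?n\<close> from the multiset. If
        \<open>?n\<close> occurs only once, \<open>?F ?n\<close> involves a truncated difference,
        but it is added and subtracted equally often.\<close>
      let ?F = "\<lambda>m. \<phi> (add_mset (?n + m) (\<mu> - {#?n, m#}))"
      have "(\<Sum>y\<in>?O. ?F (card (orbit g y))) = of_nat ?n * ?F ?n"
      proof (subst sum.cong[of ?O ?O _ "\<lambda>_. ?F ?n"])
        show "?F (card (orbit g y)) = ?F ?n" if "y \<in> ?O" for y
          using that orbit_eq_iff[OF p, of x y] by metis
      qed simp_all
      moreover have "(\<Sum>y\<in>{1..d} - ?O. ?F (card (orbit g y)))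
          = (\<Sum>y\<in>{1..d}. ?F (card (orbit g y))) - (\<Sum>y\<in>?O. ?F (card (orbit g y)))"
        using sub by (intro sum_diff) simp_all
      moreover note sum_orbit_card[OF g, of ?F, folded \<mu>_def]
      moreover have "?J ?n = (\<Sum>m\<in>#\<mu>. of_nat m * ?F m) - of_nat ?n * ?F ?n"
        using card_orbit_in_cycle_type[OF x, of g] by (intro sum_mset_remove1) (simp add: \<mu>_def)
      ultimately show ?thesis by (simp only:)
    qed
    finally show "(\<Sum>y\<in>{1..d} - {x}. ?f x y) = ?C ?n + ?J ?n" .
  qed
  also have "\<dots> = (\<Sum>n\<in>#\<mu>. of_nat n * ?C n) + (\<Sum>n\<in>#\<mu>. of_nat n * ?J n)"
    by (simp only: sum.distrib sum_orbit_card[OF g, of ?C] sum_orbit_card[OF g, of ?J]) (simp only: \<mu>_def)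
  finally show ?thesis .
qed

section \<open>Cycle types classify the conjugacy classes and exhaust the partitions\<close>

text \<open>Any bijection can be corrected by a permutation of \<open>A\<close>, since equal
  multisets of values over the same set differ by one.\<close>

lemma image_mset_mset_set_eq_bij:
  assumes fin: "finite A" "finite B"
    and eq: "image_mset f (mset_set A) = image_mset f' (mset_set B)"
  obtains \<beta> where "bij_betw \<beta> A B" "\<And>x. x \<in> A \<Longrightarrow> f' (\<beta> x) = f x"
proof -
  have "card A = card B" using arg_cong[OF eq, of size] by simp
  with fin obtain \<alpha> where \<alpha>: "bij_betw \<alpha> A B" using finite_same_card_bij by blast
  then have "mset_set B = image_mset \<alpha> (mset_set A)"
    by (simp add: bij_betw_def image_mset_mset_set)
  with eq have "image_mset f (mset_set A) = image_mset (f' \<circ> \<alpha>) (mset_set A)"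
    by (simp add: image_mset.compositionality)
  then obtain p where p: "p permutes A" "\<forall>x\<in>A. f x = (f' \<circ> \<alpha>) (p x)"
    using image_mset_eq_implies_permutes[OF fin(1)] by blast
  show ?thesis
    using bij_betw_trans[OF permutes_imp_bij[OF p(1)] \<alpha>] p(2) by (intro that[of "\<alpha> \<circ> p"]) auto
qed

text \<open>Match the cycles by a length-preserving bijection \<open>\<beta>\<close>, pick a base
  point \<open>r\<close> on each cycle of \<open>g\<close> and \<open>s\<close> on its partner, and
  send \<open>(g ^^ k) r\<close> to \<open>(g' ^^ k) s\<close>. The base points are chosen from the
  orbit as a set, so they are constant along a cycle.\<close>

lemma cycle_type_eq_imp_conj:
  assumes g: "g permutes {1..d}" and g': "g' permutes {1..d}" and eq: "cycle_type d g = cycle_type d g'"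
  obtains h where "h permutes {1..d}" "g' = h \<circ> g \<circ> inv h"
proof -
  let ?A = "{1..d}"
  have p: "permutation g" and p': "permutation g'" using g g' permutation_permutes by blast+
  note self = permutation_self_in_orbit[OF p] and self' = permutation_self_in_orbit[OF p']
  obtain \<beta> where \<beta>: "bij_betw \<beta> (orbit g ` ?A) (orbit g' ` ?A)"
    and card_\<beta>: "\<And>K. K \<in> orbit g ` ?A \<Longrightarrow> card (\<beta> K) = card K"
    using image_mset_mset_set_eq_bij[OF _ _ eq[unfolded cycle_type_def]]
    by (metis finite_atLeastAtMost finite_imageI)
  define r where "r x = (SOME z. z \<in> orbit g x)" for x
  define s where "s x = (SOME z. z \<in> \<beta> (orbit g x))" for x
  have r: "orbit g (r x) = orbit g x" for x
    using orbit_eq_iff[OF p] someI[of "\<lambda>z. z \<in> orbit g x", OF self] unfolding r_def by blast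
  have s: "orbit g' (s x) = \<beta> (orbit g x)" if x: "x \<in> ?A" for x
  proof -
    obtain z where z: "z \<in> ?A" "\<beta> (orbit g x) = orbit g' z"
      using x bij_betwE[OF \<beta>] by blast
    have "s x \<in> orbit g' z"
      unfolding s_def z(2) by (rule someI[of "\<lambda>y. y \<in> orbit g' z", OF self'])
    then show ?thesis using z orbit_eq_iff[OF p'] by metis
  qed
  have rs_cong: "r x = r y" "s x = s y" if "orbit g x = orbit g y" for x y
    using that by (simp_all add: r_def s_def)
  have ex: "\<exists>k. (g ^^ k) (r x) = x" for x
  proof -
    have "x \<in> orbit g (r x)" using self[of x] r by simp
    then obtain k where "x = (g ^^ k) (r x)" unfolding orbit_altdef_permutation[OF p] by blast
    then show ?thesis by (intro exI[of _ k]) (rule sym)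
  qed
  \<comment> \<open>The exponent is arbitrary; \<open>h_pow\<close> shows that any other gives the
    same value, because exponents of a point agree modulo the common length of the matched
    cycles.\<close>
  define h where "h x = (if x \<in> ?A then (g' ^^ (SOME k. (g ^^ k) (r x) = x)) (s x) else x)" for x
  have h_pow: "h ((g ^^ k) (r x)) = (g' ^^ k) (s x)" if x: "x \<in> ?A" for x k
  proof -
    let ?y = "(g ^^ k) (r x)"
    let ?l = "SOME k. (g ^^ k) (r ?y) = ?y"
    have yx: "orbit g ?y = orbit g x"
      using r[of x] orbit_eq_iff[OF p] funpow_in_orbit[OF self] by metis
    have y: "?y \<in> ?A" using permutes_orbit_subset[OF g x] self[of ?y] yx by blast
    have "(g ^^ ?l) (r ?y) = ?y" by (rule someI_ex[OF ex])
    then have "(g ^^ ?l) (r x) = (g ^^ k) (r x)" using rs_cong(1)[OF yx] by simp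
    then have "?l mod card (orbit g x) = k mod card (orbit g x)"
      unfolding funpow_eq_orbit[OF p] r .
    then have "(g' ^^ ?l) (s x) = (g' ^^ k) (s x)"
      unfolding funpow_eq_orbit[OF p'] s[OF x] using card_\<beta> x by simp
    then show ?thesis using y rs_cong(2)[OF yx] by (simp add: h_def)
  qed
  have comm: "h (g x) = g' (h x)" if x: "x \<in> ?A" for x
  proof -
    obtain k where k: "(g ^^ k) (r x) = x" using ex by blast
    show ?thesis using h_pow[OF x, of k] h_pow[OF x, of "Suc k"] k by simp
  qed
  have surj: "?A \<subseteq> h ` ?A"
  proof
    fix z assume z: "z \<in> ?A"
    then obtain x where x: "x \<in> ?A" "\<beta> (orbit g x) = orbit g' z"
      using bij_betw_imp_surj_on[OF \<beta>] by (metis (no_types, lifting) image_iff)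
    then have "z \<in> orbit g' (s x)" using s self' by simp
    then obtain k where k: "z = (g' ^^ k) (s x)" unfolding orbit_altdef_permutation[OF p'] by blast
    have "(g ^^ k) (r x) \<in> orbit g x"
      using r[of x] funpow_in_orbit[OF self] by metis
    then have "(g ^^ k) (r x) \<in> ?A" using permutes_orbit_subset[OF g x(1)] by blast
    then show "z \<in> h ` ?A" using h_pow[OF x(1), of k] k by (metis image_eqI)
  qed
  have "h ` ?A = ?A"
    using surj card_image_le[of ?A h] by (intro card_seteq[symmetric]) auto
  then have "bij_betw h ?A ?A"
    by (simp add: bij_betw_def eq_card_imp_inj_on)
  then have h: "h permutes ?A"
    by (rule bij_imp_permutes) (simp add: h_def del: atLeastAtMost_iff)
  have "h (g x) = g' (h x)" for x
  proof (cases "x \<in> ?A")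
    case False
    then show ?thesis using permutes_not_in[OF g] permutes_not_in[OF g'] permutes_not_in[OF h] by metis
  qed (rule comm)
  then have "g' = h \<circ> g \<circ> inv h"
    using permutes_inverses(1)[OF h] by (simp add: fun_eq_iff)
  with h show ?thesis by (rule that)
qed

text \<open>
  By joining: a permutation with a cycle of length \<open>n \<ge> 2\<close> arises from one where this cycle is
  replaced by a fixed point and a cycle of length \<open>n - 1\<close>.
\<close>

lemma ex_cycle_type:
  assumes "\<mu> \<in> partitions_of d"
  shows "\<exists>g. g permutes {1..d} \<and> cycle_type d g = \<mu>"
  using assms
\<comment> \<open>Replacing \<open>n\<close> by \<open>1\<close> and \<open>n - 1\<close> adds a
  part while a partition of \<open>d\<close> has at most \<open>d\<close> parts, so the measure
  drops.\<close>
proof (induction "d - size \<mu>" arbitrary: \<mu> rule: less_induct)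
  case less
  have \<mu>: "0 \<notin># \<mu>" "sum_mset \<mu> = d" using less.prems by (auto simp: partitions_of_def is_partition_def)
  show ?case
  proof (cases "\<exists>n\<in>#\<mu>. 2 \<le> n")
    case False
    then have ones: "\<forall>n\<in>#\<mu>. n = 1" using \<mu>(1) by (metis One_nat_def less_2_cases not_le)
    have rep: "M = replicate_mset (sum_mset M) 1" if "\<forall>n\<in>#M. n = 1" for M :: "nat multiset"
      using that by (induction M) auto
    have "orbit id x = {x}" for x :: nat by (simp add: orbit_eq_singleton_iff)
    then have "cycle_type d id = image_mset card (mset_set ((\<lambda>x. {x}) ` {1..d}))"
      by (simp add: cycle_type_def)
    also have "\<dots> = replicate_mset d 1"
      by (simp add: image_mset_mset_set[symmetric] image_mset.compositionality o_def image_mset_const_eq)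
    also have "\<dots> = \<mu>" using rep[OF ones] \<mu>(2) by simp
    finally show ?thesis using permutes_id by blast
  next
    case True
    then obtain n where n: "n \<in># \<mu>" "2 \<le> n" by blast
    from n(1) obtain M where M: "\<mu> = add_mset n M" by (blast dest: multi_member_split)
    let ?\<nu> = "add_mset 1 (add_mset (n - 1) M)"
    have \<nu>: "?\<nu> \<in> partitions_of d"
      using \<mu> n(2) by (simp add: partitions_of_def is_partition_def M)
    have "size ?\<nu> \<le> d" using \<nu> size_le_sum_mset[of ?\<nu>] by (simp add: partitions_of_def)
    then have "d - size ?\<nu> < d - size \<mu>" by (simp add: M)
    then obtain g where g: "g permutes {1..d}" "cycle_type d g = ?\<nu>"
      using less.hyps[OF _ \<nu>] by blast
    have p: "permutation g" using g permutation_permutes by blast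
    have "1 \<in># cycle_type d g" by (simp add: g)
    then obtain x where x: "x \<in> {1..d}" "card (orbit g x) = 1" by (auto simp: cycle_type_def)
    \<comment> \<open>The cycle of \<open>x\<close> is set aside before one of length
      \<open>n - 1\<close> is sought: for \<open>n = 2\<close> both are fixed points and must be
      different ones.\<close>
    let ?X = "orbit g ` {1..d} - {orbit g x}"
    have "orbit g ` {1..d} = insert (orbit g x) ?X" using x by blast
    then have "cycle_type d g = image_mset card (mset_set (insert (orbit g x) ?X))"
      unfolding cycle_type_def by (rule arg_cong)
    also have "\<dots> = add_mset 1 (image_mset card (mset_set ?X))"
      using x(2) by (subst mset_set.insert) simp_all
    finally have "image_mset card (mset_set ?X) = add_mset (n - 1) M" by (simp add: g)
    then have "n - 1 \<in> set_mset (image_mset card (mset_set ?X))" by simp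
    then have "n - 1 \<in> card ` ?X" by simp
    then obtain K where K: "n - 1 = card K" "K \<in> ?X" by (rule imageE)
    then obtain y where y: "y \<in> {1..d}" "orbit g y = K" "K \<noteq> orbit g x" by blast
    then have "y \<notin> orbit g x" using orbit_eq_iff[OF p, of x y] by simp
    from cycle_type_join[OF g(1) x(1) y(1) this]
    have "cycle_type d (transpose x y \<circ> g) = \<mu>" using n(2) by (simp add: x(2) y(2) K(1)[symmetric] g(2) M)
    moreover have "transpose x y \<circ> g permutes {1..d}"
      using g(1) x y by (intro permutes_compose permutes_swap_id)
    ultimately show ?thesis by blast
  qed
qed

section \<open>The cut-and-join recursion for characters\<close>

text \<open>The representative inside \<open>chi\<close> has the same cycle type as
  \<open>g\<close>, hence is conjugate to it, and characters are class functions.\<close>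

lemma chi_cycle_type:
  assumes g: "g permutes {1..sum_mset \<nu>}"
  shows "chi \<nu> (cycle_type (sum_mset \<nu>) g) = irr_char \<nu> g"
proof -
  let ?d = "sum_mset \<nu>" and ?\<mu> = "cycle_type (sum_mset \<nu>) g"
  have d: "sum_mset ?\<mu> = ?d"
    using sum_orbit_card[OF g, of "\<lambda>_. 1 :: nat"] by simp
  define g' where "g' = (SOME g. g \<in> conj_class ?\<mu>)"
  have "g \<in> conj_class ?\<mu>" using g by (simp add: conj_class_def d)
  then have "g' \<in> conj_class ?\<mu>" unfolding g'_def by (rule someI[of "\<lambda>g. g \<in> conj_class ?\<mu>"])
  then have g': "g' permutes {1..?d}" "cycle_type ?d g' = ?\<mu>" by (simp_all add: conj_class_def d)
  obtain h where "h permutes {1..?d}" "g' = h \<circ> g \<circ> inv h"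
    using cycle_type_eq_imp_conj[OF g g'(1) g'(2)[symmetric]] .
  then have "irr_char \<nu> g' = irr_char \<nu> g" using irr_char_conj[OF g] by simp
  then show ?thesis by (simp add: chi_def g'_def)
qed

lemma chi_cut_join:
  assumes \<mu>: "is_partition \<mu>" and \<nu>: "sum_mset \<nu> = sum_mset \<mu>"
  shows "of_int (kappa \<nu>) * chi \<nu> \<mu>
    = (\<Sum>n\<in>#\<mu>. of_nat n * (\<Sum>i\<in>{1..<n}. chi \<nu> (add_mset i (add_mset (n - i) (\<mu> - {#n#})))))
    + (\<Sum>n\<in>#\<mu>. of_nat n * (\<Sum>m\<in>#\<mu> - {#n#}. of_nat m * chi \<nu> (add_mset (n + m) (\<mu> - {#n, m#}))))"
proof -
  let ?d = "sum_mset \<nu>"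
  obtain g where g: "g permutes {1..?d}" "cycle_type ?d g = \<mu>"
    using ex_cycle_type[of \<mu> ?d] assms by (auto simp: partitions_of_def)
  have "of_int (kappa \<nu>) * chi \<nu> \<mu> = (\<Sum>(x, y)\<in>offdiag ?d. irr_char \<nu> (transpose x y \<circ> g))"
    using irr_char_transposition_sum[OF g(1)] chi_cycle_type[OF g(1)] g(2) by simp
  also have "\<dots> = (\<Sum>(x, y)\<in>offdiag ?d. chi \<nu> (cycle_type ?d (transpose x y \<circ> g)))"
  proof (intro sum.cong refl, clarify)
    fix x y assume "(x, y) \<in> offdiag ?d"
    then have "transpose x y \<circ> g permutes {1..?d}"
      using g(1) by (intro permutes_compose permutes_swap_id) (auto simp: offdiag_def)
    then show "irr_char \<nu> (transpose x y \<circ> g) = chi \<nu> (cycle_type ?d (transpose x y \<circ> g))"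
      using chi_cycle_type by metis
  qed
  also note transposition_sum_cycle_type[OF g(1), of "chi \<nu>", unfolded g(2)]
  finally show ?thesis .
qed

section \<open>The algebra of formal power series\<close>

definition ps_one :: pseries where
  "ps_one = (\<lambda>\<mu>. if \<mu> = {#} then 1 else 0)"

fun ps_power :: "pseries \<Rightarrow> nat \<Rightarrow> pseries" where
  "ps_power F 0 = ps_one"
| "ps_power F (Suc n) = ps_mult F (ps_power F n)"

lemma ps_mult_commute: "ps_mult F G = ps_mult G F"
proof
  show "ps_mult F G \<mu> = ps_mult G F \<mu>" for \<mu>
    unfolding ps_mult_def
    by (rule sum.reindex_bij_witness[of _ "\<lambda>\<alpha>. \<mu> - \<alpha>" "\<lambda>\<alpha>. \<mu> - \<alpha>"])
      (auto simp: subset_mset.le_iff_add)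
qed

lemma ps_mult_assoc: "ps_mult (ps_mult F G) H = ps_mult F (ps_mult G H)"
proof
  fix \<mu>
  have "ps_mult (ps_mult F G) H \<mu> = (\<Sum>(\<gamma>, \<alpha>)\<in>(SIGMA \<gamma>:{\<gamma>. \<gamma> \<subseteq># \<mu>}. {\<alpha>. \<alpha> \<subseteq># \<gamma>}). F \<alpha> * G (\<gamma> - \<alpha>) * H (\<mu> - \<gamma>))"
    unfolding ps_mult_def sum_distrib_right
    by (subst sum.Sigma) (auto simp: finite_submultisets)
  also have "\<dots> = (\<Sum>(\<alpha>, \<beta>)\<in>(SIGMA \<alpha>:{\<alpha>. \<alpha> \<subseteq># \<mu>}. {\<beta>. \<beta> \<subseteq># \<mu> - \<alpha>}). F \<alpha> * (G \<beta> * H (\<mu> - \<alpha> - \<beta>)))"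
    by (rule sum.reindex_bij_witness[of _ "\<lambda>(\<alpha>, \<beta>). (\<alpha> + \<beta>, \<alpha>)" "\<lambda>(\<gamma>, \<alpha>). (\<alpha>, \<gamma> - \<alpha>)"])
      (auto simp: mult.assoc subset_mset.le_iff_add)
  also have "\<dots> = ps_mult F (ps_mult G H) \<mu>"
    unfolding ps_mult_def sum_distrib_left
    by (subst sum.Sigma) (auto simp: finite_submultisets)
  finally show "ps_mult (ps_mult F G) H \<mu> = ps_mult F (ps_mult G H) \<mu>" .
qed

lemma ps_mult_one [simp]: "ps_mult ps_one F = F"
proof
  fix \<mu>
  have "ps_mult ps_one F \<mu> = (\<Sum>\<alpha>\<in>{{#}}. ps_one \<alpha> * F (\<mu> - \<alpha>))"
    unfolding ps_mult_def by (rule sum.mono_neutral_right) (auto simp: finite_submultisets ps_one_def)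
  then show "ps_mult ps_one F \<mu> = F \<mu>" by (simp add: ps_one_def)
qed

lemma ps_mult_add_left: "ps_mult (\<lambda>\<mu>. F \<mu> + G \<mu>) H = (\<lambda>\<mu>. ps_mult F H \<mu> + ps_mult G H \<mu>)"
  by (simp add: ps_mult_def fun_eq_iff distrib_right sum.distrib)

lemma ps_mult_add_right: "ps_mult F (\<lambda>\<mu>. G \<mu> + H \<mu>) = (\<lambda>\<mu>. ps_mult F G \<mu> + ps_mult F H \<mu>)"
  by (simp add: ps_mult_def fun_eq_iff distrib_left sum.distrib)

lemma ps_mult_scale_right: "ps_mult F (\<lambda>\<mu>. c * G \<mu>) = (\<lambda>\<mu>. c * ps_mult F G \<mu>)"
  by (simp add: ps_mult_def fun_eq_iff sum_distrib_left mult_ac)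

text \<open>Without a constant term each of the \<open>n\<close> factors uses up at least one
  variable. This is what truncates the logarithm and the geometric series at a given
  monomial.\<close>

lemma ps_power_eq_0:
  assumes "F {#} = 0" "size \<mu> < n"
  shows "ps_power F n \<mu> = 0"
  using assms(2)
proof (induction n arbitrary: \<mu>)
  case (Suc n)
  have "F \<alpha> * ps_power F n (\<mu> - \<alpha>) = 0" if "\<alpha> \<subseteq># \<mu>" for \<alpha>
  proof (cases "\<alpha> = {#}")
    case False
    then have "size (\<mu> - \<alpha>) < n"
      using that Suc.prems size_mset_mono[OF that] nonempty_has_size[of \<alpha>] by (simp add: size_Diff_submset)
    then show ?thesis using Suc.IH by simp
  qed (use assms in simp)
  then show ?case by (simp only: ps_power.simps ps_mult_def) (rule sum.neutral, blast)
qed simp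

lemma ps_power_mult_eq_0:
  assumes "F {#} = 0" "size \<mu> < n"
  shows "ps_mult (ps_power F n) G \<mu> = 0"
proof -
  have "ps_power F n \<alpha> = 0" if "\<alpha> \<subseteq># \<mu>" for \<alpha>
    using assms size_mset_mono[OF that] by (intro ps_power_eq_0) auto
  then show ?thesis by (simp add: ps_mult_def)
qed

text \<open>The coefficient of the product at \<open>\<mu>\<close> is \<open>F \<mu>\<close> plus
  terms that involve \<open>F\<close> only at shorter monomials; induction on the length recovers
  \<open>F\<close>.\<close>

lemma ps_mult_left_cancel:
  assumes E: "E {#} = 1" and eq: "ps_mult E F = ps_mult E G"
  shows "F = G"
proof
  show "F \<mu> = G \<mu>" for \<mu>
  proof (induction "size \<mu>" arbitrary: \<mu> rule: less_induct)
    case less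
    have *: "ps_mult E H \<mu> = H \<mu> + (\<Sum>\<alpha>\<in>{\<alpha>. \<alpha> \<subseteq># \<mu>} - {{#}}. E \<alpha> * H (\<mu> - \<alpha>))" for H
      unfolding ps_mult_def by (subst sum.remove[of _ "{#}"]) (auto simp: finite_submultisets E)
    have "F (\<mu> - \<alpha>) = G (\<mu> - \<alpha>)" if "\<alpha> \<in> {\<alpha>. \<alpha> \<subseteq># \<mu>} - {{#}}" for \<alpha>
    proof (rule less)
      have "\<alpha> \<subseteq># \<mu>" "\<alpha> \<noteq> {#}" using that by auto
      then show "size (\<mu> - \<alpha>) < size \<mu>"
        using size_mset_mono[of \<alpha> \<mu>] nonempty_has_size[of \<alpha>] by (simp add: size_Diff_submset)
    qed
    then have "(\<Sum>\<alpha>\<in>{\<alpha>. \<alpha> \<subseteq># \<mu>} - {{#}}. E \<alpha> * F (\<mu> - \<alpha>)) = (\<Sum>\<alpha>\<in>{\<alpha>. \<alpha> \<subseteq># \<mu>} - {{#}}. E \<alpha> * G (\<mu> - \<alpha>))"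
      by (intro sum.cong) auto
    with fun_cong[OF eq, of \<mu>] show ?case unfolding * by simp
  qed
qed

text \<open>The factor \<open>count (add_mset i \<mu>) i\<close> from the derivative splits into the
  count in \<open>\<alpha>\<close> and the count in its complement. Each half keeps only the
  \<open>\<alpha>\<close> for which its count is nonzero, that is, for which the extra
  \<open>i\<close> can be removed from that side.\<close>

lemma p_deriv_mult:
  "p_deriv i (ps_mult F G) = (\<lambda>\<mu>. ps_mult (p_deriv i F) G \<mu> + ps_mult F (p_deriv i G) \<mu>)"
proof
  fix \<mu>
  let ?\<mu> = "add_mset i \<mu>"
  let ?S = "{\<alpha>. \<alpha> \<subseteq># ?\<mu>}" and ?T = "{\<alpha>. \<alpha> \<subseteq># \<mu>}"
  have "p_deriv i (ps_mult F G) \<mu> = (\<Sum>\<alpha>\<in>?S. of_nat (count ?\<mu> i) * (F \<alpha> * G (?\<mu> - \<alpha>)))"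
    by (simp add: p_deriv_def ps_mult_def sum_distrib_left)
  also have "\<dots> = (\<Sum>\<alpha>\<in>?S. of_nat (count \<alpha> i) * F \<alpha> * G (?\<mu> - \<alpha>) + F \<alpha> * (of_nat (count (?\<mu> - \<alpha>) i) * G (?\<mu> - \<alpha>)))"
  proof (rule sum.cong[OF refl])
    fix \<alpha> assume "\<alpha> \<in> ?S"
    then have "count \<alpha> i \<le> count ?\<mu> i" by (simp add: mset_subset_eq_count del: count_add_mset)
    then have "count ?\<mu> i = count \<alpha> i + count (?\<mu> - \<alpha>) i" by simp
    then have "(of_nat (count ?\<mu> i) :: complex) = of_nat (count \<alpha> i) + of_nat (count (?\<mu> - \<alpha>) i)"
      by (metis of_nat_add)
    then show "of_nat (count ?\<mu> i) * (F \<alpha> * G (?\<mu> - \<alpha>)) = of_nat (count \<alpha> i) * F \<alpha> * G (?\<mu> - \<alpha>) + F \<alpha> * (of_nat (count (?\<mu> - \<alpha>) i) * G (?\<mu> - \<alpha>))"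
      by (simp only:) (simp add: algebra_simps)
  qed
  also have "\<dots> = (\<Sum>\<alpha>\<in>?S. of_nat (count \<alpha> i) * F \<alpha> * G (?\<mu> - \<alpha>)) + (\<Sum>\<alpha>\<in>?S. F \<alpha> * (of_nat (count (?\<mu> - \<alpha>) i) * G (?\<mu> - \<alpha>)))"
    by (rule sum.distrib)
  also have "(\<Sum>\<alpha>\<in>?S. of_nat (count \<alpha> i) * F \<alpha> * G (?\<mu> - \<alpha>)) = (\<Sum>\<alpha>\<in>add_mset i ` ?T. of_nat (count \<alpha> i) * F \<alpha> * G (?\<mu> - \<alpha>))"
  proof (rule sum.mono_neutral_right)
    show "\<forall>\<alpha>\<in>?S - add_mset i ` ?T. of_nat (count \<alpha> i) * F \<alpha> * G (?\<mu> - \<alpha>) = 0"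
    proof
      fix \<alpha> assume \<alpha>: "\<alpha> \<in> ?S - add_mset i ` ?T"
      have "i \<notin># \<alpha>"
      proof
        assume "i \<in># \<alpha>"
        then obtain \<beta> where "\<alpha> = add_mset i \<beta>" by (blast dest: multi_member_split)
        with \<alpha> show False by auto
      qed
      then show "of_nat (count \<alpha> i) * F \<alpha> * G (?\<mu> - \<alpha>) = 0" by (simp add: not_in_iff)
    qed
  qed (auto simp: finite_submultisets)
  also have "\<dots> = ps_mult (p_deriv i F) G \<mu>"
    by (subst sum.reindex) (auto simp: inj_on_def ps_mult_def p_deriv_def)
  also have "(\<Sum>\<alpha>\<in>?S. F \<alpha> * (of_nat (count (?\<mu> - \<alpha>) i) * G (?\<mu> - \<alpha>))) = (\<Sum>\<alpha>\<in>?T. F \<alpha> * (of_nat (count (?\<mu> - \<alpha>) i) * G (?\<mu> - \<alpha>)))"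
  proof (rule sum.mono_neutral_right)
    show "?T \<subseteq> ?S" by (auto simp: subset_mset.le_iff_add)
    show "\<forall>\<alpha>\<in>?S - ?T. F \<alpha> * (of_nat (count (?\<mu> - \<alpha>) i) * G (?\<mu> - \<alpha>)) = 0"
    proof
      fix \<alpha> assume \<alpha>: "\<alpha> \<in> ?S - ?T"
      have "i \<notin># ?\<mu> - \<alpha>"
      proof
        assume "i \<in># ?\<mu> - \<alpha>"
        then have "count \<alpha> i \<le> count \<mu> i" by (simp add: in_diff_count)
        moreover have "count \<alpha> j \<le> count \<mu> j" if "j \<noteq> i" for j
          using \<alpha> that by (auto simp: subseteq_mset_def dest!: spec[of _ j])
        ultimately have "\<alpha> \<subseteq># \<mu>" by (metis subseteq_mset_def)
        with \<alpha> show False by simp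
      qed
      then show "F \<alpha> * (of_nat (count (?\<mu> - \<alpha>) i) * G (?\<mu> - \<alpha>)) = 0" by (simp add: not_in_iff)
    qed
  qed (auto simp: finite_submultisets)
  also have "\<dots> = ps_mult F (p_deriv i G) \<mu>"
    unfolding ps_mult_def
  proof (rule sum.cong[OF refl])
    fix \<alpha> assume "\<alpha> \<in> ?T"
    then have "?\<mu> - \<alpha> = add_mset i (\<mu> - \<alpha>)" by (simp add: multiset_diff_union_assoc[of \<alpha> \<mu> "{#i#}", simplified])
    then show "F \<alpha> * (of_nat (count (?\<mu> - \<alpha>) i) * G (?\<mu> - \<alpha>)) = F \<alpha> * p_deriv i G (\<mu> - \<alpha>)"
      by (simp add: p_deriv_def)
  qed
  finally show "p_deriv i (ps_mult F G) \<mu> = ps_mult (p_deriv i F) G \<mu> + ps_mult F (p_deriv i G) \<mu>" .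
qed

lemma p_mult_ps_mult: "p_mult k (ps_mult F G) = ps_mult F (p_mult k G)"
proof
  fix \<mu>
  have sub: "\<alpha> \<subseteq># \<mu> \<and> k \<in># \<mu> - \<alpha> \<longleftrightarrow> k \<in># \<mu> \<and> \<alpha> \<subseteq># \<mu> - {#k#}" for \<alpha>
    unfolding insert_subset_eq_iff[symmetric]
    by (auto simp: subset_mset.le_iff_add dest!: multi_member_split)
  have "ps_mult F (p_mult k G) \<mu> = (\<Sum>\<alpha>\<in>{\<alpha>. \<alpha> \<subseteq># \<mu> \<and> k \<in># \<mu> - \<alpha>}. F \<alpha> * G (\<mu> - \<alpha> - {#k#}))"
    unfolding ps_mult_def p_mult_def
    by (rule sum.mono_neutral_cong_right) (auto simp: finite_submultisets)
  also have "\<dots> = p_mult k (ps_mult F G) \<mu>"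
    unfolding sub by (simp add: p_mult_def ps_mult_def diff_right_commute)
  finally show "p_mult k (ps_mult F G) \<mu> = ps_mult F (p_mult k G) \<mu>" ..
qed

lemma p_deriv_power:
  "p_deriv i (ps_power F (Suc n)) = (\<lambda>\<mu>. of_nat (Suc n) * ps_mult (ps_power F n) (p_deriv i F) \<mu>)"
proof (induction n)
  case 0
  have "p_deriv i ps_one = (\<lambda>_. 0)" by (simp add: p_deriv_def ps_one_def)
  then have "p_deriv i (ps_mult F ps_one) = (\<lambda>\<mu>. ps_mult (p_deriv i F) ps_one \<mu>)"
    unfolding p_deriv_mult by (simp add: ps_mult_def)
  then show ?case by (simp add: ps_mult_commute[of _ ps_one])
next
  case (Suc n)
  have "p_deriv i (ps_power F (Suc (Suc n)))
      = (\<lambda>\<mu>. ps_mult (p_deriv i F) (ps_power F (Suc n)) \<mu> + ps_mult F (p_deriv i (ps_power F (Suc n))) \<mu>)"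
    by (simp only: ps_power.simps(2)[of F "Suc n"] p_deriv_mult)
  also have "\<dots> = (\<lambda>\<mu>. of_nat (Suc (Suc n)) * ps_mult (ps_power F (Suc n)) (p_deriv i F) \<mu>)"
    unfolding Suc.IH ps_mult_scale_right
    by (simp add: ps_mult_assoc ps_mult_commute[of "p_deriv i F"] algebra_simps)
  finally show ?case .
qed

lemma has_coeff_derivative_mult:
  assumes "has_coeff_derivative F F' t" "has_coeff_derivative G G' t"
  shows "has_coeff_derivative (\<lambda>s. ps_mult (F s) (G s)) (\<lambda>\<mu>. ps_mult F' (G t) \<mu> + ps_mult (F t) G' \<mu>) t"
  using assms unfolding has_coeff_derivative_def ps_mult_def sum.distrib[symmetric]
  by (auto intro!: derivative_eq_intros sum.cong)

lemma has_coeff_derivative_power: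
  assumes F: "has_coeff_derivative F F' t"
  shows "has_coeff_derivative (\<lambda>s. ps_power (F s) (Suc n)) (\<lambda>\<mu>. of_nat (Suc n) * ps_mult (ps_power (F t) n) F' \<mu>) t"
proof (induction n)
  case 0
  have "ps_power (F s) (Suc 0) = F s" for s by (simp add: ps_mult_commute[of _ ps_one])
  with F show ?case by simp
next
  case (Suc n)
  have "(\<lambda>\<mu>. ps_mult F' (ps_power (F t) (Suc n)) \<mu> + ps_mult (F t) (\<lambda>\<mu>. of_nat (Suc n) * ps_mult (ps_power (F t) n) F' \<mu>) \<mu>)
      = (\<lambda>\<mu>. of_nat (Suc (Suc n)) * ps_mult (ps_power (F t) (Suc n)) F' \<mu>)"
    unfolding ps_mult_scale_right
    by (simp add: ps_mult_assoc ps_mult_commute[of F'] algebra_simps)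
  with has_coeff_derivative_mult[OF F Suc.IH] show ?case
    by (simp only: ps_power.simps(2)[of _ "Suc n"])
qed

text \<open>
  \<open>L = W / (1 + U)\<close>, applied with \<open>W\<close> the derivative of \<open>U\<close>. The partial sums stabilize at \<open>\<mu>\<close>
  because \<open>U\<close> has no constant term.
\<close>

lemma geometric_series_mult:
  assumes U: "U {#} = 0" and L: "\<And>\<mu> N. size \<mu> < N \<Longrightarrow> L \<mu> = (\<Sum>n<N. (-1) ^ n * ps_mult (ps_power U n) W \<mu>)"
  shows "ps_mult (\<lambda>\<mu>. ps_one \<mu> + U \<mu>) L = W"
proof
  fix \<mu> :: "nat multiset"
  define N where "N = Suc (size \<mu>)"
  let ?P = "\<lambda>n. ps_mult (ps_power U n) W"
  have "ps_mult U L \<mu> = (\<Sum>\<alpha> | \<alpha> \<subseteq># \<mu>. U \<alpha> * (\<Sum>n<N. (-1) ^ n * ?P n (\<mu> - \<alpha>)))"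
    unfolding ps_mult_def[of U]
  proof (rule sum.cong[OF refl])
    fix \<alpha> assume "\<alpha> \<in> {\<alpha>. \<alpha> \<subseteq># \<mu>}"
    have "size (\<mu> - \<alpha>) < N" using size_mset_mono[of "\<mu> - \<alpha>" \<mu>] by (simp add: N_def)
    from L[OF this] show "U \<alpha> * L (\<mu> - \<alpha>) = U \<alpha> * (\<Sum>n<N. (-1) ^ n * ?P n (\<mu> - \<alpha>))" by simp
  qed
  also have "\<dots> = (\<Sum>n<N. (-1) ^ n * ps_mult U (?P n) \<mu>)"
    unfolding ps_mult_def[of U] sum_distrib_left by (subst sum.swap) (simp add: mult_ac)
  also have "\<dots> = (\<Sum>n<N. (-1) ^ n * ?P (Suc n) \<mu>)"
    by (simp add: ps_mult_assoc)
  finally have "ps_mult (\<lambda>\<mu>. ps_one \<mu> + U \<mu>) L \<mu> = (\<Sum>n<N. (-1) ^ n * ?P n \<mu>) + (\<Sum>n<N. (-1) ^ n * ?P (Suc n) \<mu>)"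
    using L[of \<mu> N] by (simp add: ps_mult_add_left N_def)
  \<comment> \<open>The product with \<open>1 + U\<close> telescopes to \<open>W\<close> minus a
    remainder with \<open>N\<close> factors \<open>U\<close>, which vanishes since \<open>N\<close>
    exceeds the length of the monomial.\<close>
  also have "\<dots> = (\<Sum>n<N. (-1) ^ n * ?P n \<mu> - (-1) ^ Suc n * ?P (Suc n) \<mu>)"
    by (simp add: sum.distrib[symmetric])
  also have "\<dots> = ?P 0 \<mu> - (-1) ^ N * ?P N \<mu>"
    by (subst sum_lessThan_telescope') simp
  also have "?P N \<mu> = 0" by (rule ps_power_mult_eq_0[of U, OF U]) (simp add: N_def)
  finally show "ps_mult (\<lambda>\<mu>. ps_one \<mu> + U \<mu>) L \<mu> = W \<mu>" by simp
qed

section \<open>The logarithm\<close>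

text \<open>\<open>R_bullet\<close> without its constant term, the \<open>U\<close> in
  \<open>log (1 + U)\<close>; restricting to nonempty partitions matches the entries allowed in
  \<open>splittings\<close>.\<close>

definition log_arg :: "complex \<Rightarrow> complex \<Rightarrow> pseries" where
  "log_arg lam \<tau> = (\<lambda>\<mu>. if is_partition \<mu> \<and> \<mu> \<noteq> {#} then R_bullet_coeff lam \<tau> \<mu> else 0)"

lemma log_arg_empty: "log_arg lam \<tau> {#} = 0"
  by (simp add: log_arg_def)

lemma R_bullet_eq: "R_bullet lam \<tau> = (\<lambda>\<mu>. ps_one \<mu> + log_arg lam \<tau> \<mu>)"
proof
  show "R_bullet lam \<tau> \<mu> = ps_one \<mu> + log_arg lam \<tau> \<mu>" for \<mu>
    using R_bullet_empty[of lam \<tau>] by (cases "\<mu> = {#}") (simp_all add: ps_one_def log_arg_def R_bullet_def)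
qed

text \<open>The head of a tuple is the monomial taken from the first factor of the power, the tail a
  splitting of what is left.\<close>

lemma sum_splittings:
  "(\<Sum>ms\<in>splittings n \<mu>. \<Prod>\<xi>\<leftarrow>ms. R_bullet_coeff lam \<tau> \<xi>) = ps_power (log_arg lam \<tau>) n \<mu>"
proof (induction n arbitrary: \<mu>)
  case 0
  have "splittings 0 \<mu> = (if \<mu> = {#} then {[]} else {})" by (auto simp: splittings_def)
  then show ?case by (simp add: ps_one_def)
next
  case (Suc n)
  let ?c = "R_bullet_coeff lam \<tau>"
  let ?A = "{\<alpha>. \<alpha> \<subseteq># \<mu> \<and> is_partition \<alpha> \<and> \<alpha> \<noteq> {#}}"
  have fin: "finite ?A" by (rule finite_subset[OF _ finite_submultisets[of \<mu>]]) auto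
  have "(\<Sum>ms\<in>splittings (Suc n) \<mu>. \<Prod>\<xi>\<leftarrow>ms. ?c \<xi>)
      = (\<Sum>(\<alpha>, ms)\<in>(SIGMA \<alpha>:?A. splittings n (\<mu> - \<alpha>)). ?c \<alpha> * (\<Prod>\<xi>\<leftarrow>ms. ?c \<xi>))"
  proof (rule sum.reindex_bij_witness[of _ "\<lambda>(\<alpha>, ms). \<alpha> # ms" "\<lambda>ms. (hd ms, tl ms)"])
    fix ms assume "ms \<in> splittings (Suc n) \<mu>"
    then obtain \<alpha> ms' where ms: "ms = \<alpha> # ms'" and "length ms' = n" "is_partition \<alpha>" "\<alpha> \<noteq> {#}"
      "\<forall>\<xi>\<in>set ms'. is_partition \<xi> \<and> \<xi> \<noteq> {#}" "\<mu> = \<alpha> + sum_list ms'"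
      by (auto simp: splittings_def length_Suc_conv)
    then show "(case (hd ms, tl ms) of (\<alpha>, ms) \<Rightarrow> \<alpha> # ms) = ms"
      "(hd ms, tl ms) \<in> (SIGMA \<alpha>:?A. splittings n (\<mu> - \<alpha>))"
      "(case (hd ms, tl ms) of (\<alpha>, ms) \<Rightarrow> ?c \<alpha> * (\<Prod>\<xi>\<leftarrow>ms. ?c \<xi>)) = (\<Prod>\<xi>\<leftarrow>ms. ?c \<xi>)"
      by (auto simp: splittings_def)
  qed (auto simp: splittings_def)
  also have "\<dots> = (\<Sum>\<alpha>\<in>?A. ?c \<alpha> * ps_power (log_arg lam \<tau>) n (\<mu> - \<alpha>))"
    using fin by (subst sum.Sigma[symmetric]) (auto simp: finite_splittings sum_distrib_left[symmetric] Suc.IH)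
  also have "\<dots> = ps_power (log_arg lam \<tau>) (Suc n) \<mu>"
    unfolding ps_power.simps ps_mult_def
    by (rule sum.mono_neutral_cong_left) (auto simp: finite_submultisets log_arg_def)
  finally show ?case .
qed

lemma R_term_eq: "R_term lam \<tau> n = (\<lambda>\<mu>. (-1) ^ (n - 1) / of_nat n * ps_power (log_arg lam \<tau>) n \<mu>)"
  unfolding R_term_def sum_splittings ..

text \<open>The logarithm series with its index shifted by one. The cutoff \<open>N\<close> is left
  free so that one cutoff can serve several monomials at once.\<close>

lemma R_eq:
  assumes "size \<mu> < N"
  shows "R lam \<tau> \<mu> = (\<Sum>n<N. (-1) ^ n / of_nat (Suc n) * ps_power (log_arg lam \<tau>) (Suc n) \<mu>)"
proof -
  have z: "R_term lam \<tau> n \<mu> = 0" if "size \<mu> < n" for n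
    using ps_power_eq_0[of "log_arg lam \<tau>", OF log_arg_empty that] by (simp add: R_term_eq)
  have "R lam \<tau> \<mu> = (\<Sum>n\<in>{1..N}. R_term lam \<tau> n \<mu>)"
    unfolding R_def formal_sum_def
  proof (rule sum.mono_neutral_left)
    show "{i \<in> {1..}. R_term lam \<tau> i \<mu> \<noteq> 0} \<subseteq> {1..N}"
    proof
      fix i assume i: "i \<in> {i \<in> {1..}. R_term lam \<tau> i \<mu> \<noteq> 0}"
      then have "\<not> size \<mu> < i" using z by blast
      with i assms show "i \<in> {1..N}" by simp
    qed
  qed auto
  also have "\<dots> = (\<Sum>n<N. R_term lam \<tau> (Suc n) \<mu>)"
    by (rule sum.reindex_bij_witness[of _ Suc "\<lambda>n. n - 1"]) auto
  finally show ?thesis by (simp only: R_term_eq diff_Suc_1)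
qed

text \<open>The logarithmic derivative: differentiating \<open>U ^ (n + 1) / (n + 1)\<close> gives
  \<open>U ^ n\<close> times the derivative of \<open>U\<close>, a geometric series that
  \<open>geometric_series_mult\<close> sums.\<close>

lemma R_bullet_mult_p_deriv_R: "ps_mult (R_bullet lam \<tau>) (p_deriv i (R lam \<tau>)) = p_deriv i (R_bullet lam \<tau>)"
proof -
  let ?U = "log_arg lam \<tau>"
  have "ps_mult (R_bullet lam \<tau>) (p_deriv i (R lam \<tau>)) = p_deriv i ?U"
    unfolding R_bullet_eq
  proof (rule geometric_series_mult[of "log_arg lam \<tau>", OF log_arg_empty])
    fix \<mu> :: "nat multiset" and N assume N: "size \<mu> < N"
    \<comment> \<open>The derivative reads \<open>R\<close> at a monomial longer by one, so the
      cutoff is \<open>Suc N\<close>. After differentiation the extra term vanishes at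
      \<open>\<mu>\<close> and the cutoff returns to \<open>N\<close>.\<close>
    have "p_deriv i (R lam \<tau>) \<mu>
        = of_nat (count \<mu> i + 1) * (\<Sum>n<Suc N. (-1) ^ n / of_nat (Suc n) * ps_power ?U (Suc n) (add_mset i \<mu>))"
      using R_eq[of "add_mset i \<mu>" "Suc N" lam \<tau>] N by (simp only: p_deriv_def size_add_mset Suc_less_eq)
    also have "\<dots> = (\<Sum>n<Suc N. (-1) ^ n / of_nat (Suc n) * p_deriv i (ps_power ?U (Suc n)) \<mu>)"
      unfolding sum_distrib_left by (simp only: p_deriv_def mult_ac)
    also have "\<dots> = (\<Sum>n<Suc N. (-1) ^ n * ps_mult (ps_power ?U n) (p_deriv i ?U) \<mu>)"
      unfolding p_deriv_power by (intro sum.cong refl) (simp del: of_nat_Suc)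
    also have "\<dots> = (\<Sum>n<N. (-1) ^ n * ps_mult (ps_power ?U n) (p_deriv i ?U) \<mu>)"
      using ps_power_mult_eq_0[of "log_arg lam \<tau>", OF log_arg_empty N] by simp
    finally show "p_deriv i (R lam \<tau>) \<mu> = \<dots>" .
  qed
  also have "p_deriv i ?U = p_deriv i (R_bullet lam \<tau>)"
    by (simp add: R_bullet_eq p_deriv_def ps_one_def)
  finally show ?thesis .
qed

text \<open>Differentiability of \<open>R\<close> is part of the claim. It holds because each
  coefficient is a finite sum whose length does not vary with the parameter; the derivative
  \<open>R'\<close> is the geometric series for \<open>E' / (1 + U)\<close>.\<close>

lemma has_coeff_derivative_R:
  assumes E: "has_coeff_derivative (R_bullet lam) E' \<tau>"
  obtains R' where "has_coeff_derivative (R lam) R' \<tau>" "ps_mult (R_bullet lam \<tau>) R' = E'"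
proof -
  let ?U = "log_arg lam \<tau>"
  have U: "has_coeff_derivative (log_arg lam) E' \<tau>"
  proof -
    have "(\<lambda>s. log_arg lam s \<mu>) = (\<lambda>s. R_bullet lam s \<mu> - ps_one \<mu>)" for \<mu>
      by (simp add: R_bullet_eq)
    then show ?thesis
      using E unfolding has_coeff_derivative_def by (auto intro!: derivative_eq_intros)
  qed
  let ?P = "\<lambda>n \<mu>. (-1) ^ n * ps_mult (ps_power ?U n) E' \<mu>"
  define R' where "R' \<mu> = (\<Sum>n<Suc (size \<mu>). ?P n \<mu>)" for \<mu> :: "nat multiset"
  have R': "R' \<mu> = (\<Sum>n<N. ?P n \<mu>)" if "size \<mu> < N" for \<mu> :: "nat multiset" and N
    unfolding R'_def
  proof (rule sum.mono_neutral_left)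
    show "\<forall>n\<in>{..<N} - {..<Suc (size \<mu>)}. ?P n \<mu> = 0"
      by (auto simp: ps_power_mult_eq_0[of "log_arg lam \<tau>", OF log_arg_empty])
  qed (use that in auto)
  have "has_coeff_derivative (R lam) R' \<tau>"
    unfolding has_coeff_derivative_def
  proof
    fix \<mu> :: "nat multiset"
    let ?N = "Suc (size \<mu>)"
    have "((\<lambda>s. (-1) ^ n / of_nat (Suc n) * ps_power (log_arg lam s) (Suc n) \<mu>) has_field_derivative ?P n \<mu>) (at \<tau>)" for n
    proof -
      have "((\<lambda>s. ps_power (log_arg lam s) (Suc n) \<mu>) has_field_derivative
          of_nat (Suc n) * ps_mult (ps_power ?U n) E' \<mu>) (at \<tau>)"
        using has_coeff_derivative_power[OF U] unfolding has_coeff_derivative_def by blast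
      from DERIV_cmult[OF this, of "(-1) ^ n / of_nat (Suc n)"] show ?thesis
        by (simp del: of_nat_Suc ps_power.simps)
    qed
    then have "((\<lambda>s. \<Sum>n<?N. (-1) ^ n / of_nat (Suc n) * ps_power (log_arg lam s) (Suc n) \<mu>)
        has_field_derivative (\<Sum>n<?N. ?P n \<mu>)) (at \<tau>)"
      by (intro DERIV_sum)
    then show "((\<lambda>s. R lam s \<mu>) has_field_derivative R' \<mu>) (at \<tau>)"
      unfolding R'_def R_eq[OF lessI[of "size \<mu>"]] .
  qed
  moreover have "ps_mult (R_bullet lam \<tau>) R' = E'"
    unfolding R_bullet_eq using R' by (rule geometric_series_mult[of "log_arg lam \<tau>", OF log_arg_empty])
  ultimately show ?thesis by (rule that)
qed

section \<open>The cut-and-join operator\<close>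

text \<open>An index of multiplicity 0 contributes the factor 1, so products over different supports
  can be compared on a common one.\<close>

lemma prod_eq_z_part:
  assumes "finite S" "set_mset \<mu> \<subseteq> S"
  shows "(\<Prod>j\<in>S. fact (count \<mu> j) * j ^ count \<mu> j) = z_part \<mu>"
  unfolding z_part_def using assms by (intro prod.mono_neutral_right) (auto simp: not_in_iff)

lemma z_part_add_mset: "z_part (add_mset a \<mu>) = a * (count \<mu> a + 1) * z_part \<mu>"
proof -
  let ?S = "insert a (set_mset \<mu>)"
  let ?f = "\<lambda>\<mu> j. fact (count \<mu> j) * j ^ count \<mu> j :: nat"
  have "z_part (add_mset a \<mu>) = (\<Prod>j\<in>?S. ?f (add_mset a \<mu>) j)"
    by (rule prod_eq_z_part[symmetric]) auto
  also have "\<dots> = ?f (add_mset a \<mu>) a * (\<Prod>j\<in>?S - {a}. ?f (add_mset a \<mu>) j)"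
    by (rule prod.remove) auto
  also have "(\<Prod>j\<in>?S - {a}. ?f (add_mset a \<mu>) j) = (\<Prod>j\<in>?S - {a}. ?f \<mu> j)"
    by (rule prod.cong) auto
  also have "?f (add_mset a \<mu>) a = a * (count \<mu> a + 1) * ?f \<mu> a"
    by (simp add: algebra_simps)
  also have "a * (count \<mu> a + 1) * ?f \<mu> a * (\<Prod>j\<in>?S - {a}. ?f \<mu> j) = a * (count \<mu> a + 1) * (\<Prod>j\<in>?S. ?f \<mu> j)"
    by (subst (2) prod.remove[of _ a]) (auto simp: mult_ac)
  also have "(\<Prod>j\<in>?S. ?f \<mu> j) = z_part \<mu>"
    by (rule prod_eq_z_part) auto
  finally show ?thesis .
qed

lemma z_part_pos: "is_partition \<mu> \<Longrightarrow> 0 < z_part \<mu>"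
  by (induction \<mu>) (auto simp: z_part_add_mset is_partition_def, simp add: z_part_def)

definition cut_join :: "pseries \<Rightarrow> nat \<times> nat \<Rightarrow> pseries" where
  "cut_join F = (\<lambda>(i, j) \<mu>. of_nat (i * j) * p_mult (i + j) (p_deriv i (p_deriv j F)) \<mu>
     + of_nat (i + j) * p_mult i (p_mult j (p_deriv (i + j) F)) \<mu>)"

text \<open>By \<open>z_part_add_mset\<close> every part \<open>a\<close> inserted by a derivative
  divides by \<open>a\<close> times its new multiplicity. The multiplicities cancel those of
  \<open>p_deriv\<close> and the parts cancel the factor \<open>i * j\<close> or
  \<open>i + j\<close>. Relating what remains to \<open>z_part \<mu>\<close> leaves part times
  multiplicity for each part removed from \<open>\<mu>\<close>, the number of points on cycles of
  that length.\<close>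

lemma cut_join_coeff:
  fixes F :: pseries
  assumes \<mu>: "is_partition \<mu>" and ij: "1 \<le> i" "1 \<le> j"
    and F: "\<And>\<xi>. is_partition \<xi> \<Longrightarrow> sum_mset \<xi> = sum_mset \<mu> \<Longrightarrow> F \<xi> = G \<xi> / of_nat (z_part \<xi>)"
  shows "cut_join F (i, j) \<mu> =
      (of_nat (count \<mu> (i + j)) * (of_nat (i + j) * G (add_mset i (add_mset j (\<mu> - {#i + j#}))))
     + of_nat (count \<mu> i) * (of_nat i * (of_nat (count (\<mu> - {#i#}) j) * (of_nat j * G (add_mset (i + j) (\<mu> - {#i, j#}))))))
     / of_nat (z_part \<mu>)"
proof -
  have "of_nat (i * j) * p_mult (i + j) (p_deriv i (p_deriv j F)) \<mu>
      = of_nat (count \<mu> (i + j)) * (of_nat (i + j) * G (add_mset i (add_mset j (\<mu> - {#i + j#})))) / of_nat (z_part \<mu>)"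
  proof (cases "i + j \<in># \<mu>")
    case True
    then obtain \<alpha> where \<alpha>: "\<mu> = add_mset (i + j) \<alpha>" by (blast dest: multi_member_split)
    have p: "is_partition \<alpha>" using \<mu> by (simp add: \<alpha> is_partition_def)
    then have z: "of_nat (z_part \<alpha>) \<noteq> (0 :: complex)" using z_part_pos[of \<alpha>] by simp
    let ?\<xi> = "add_mset j (add_mset i \<alpha>)"
    \<comment> \<open>Multiplicities in the order in which the parts are inserted; the second count
      already sees the first insertion, which covers \<open>i = j\<close> without a case
      distinction.\<close>
    define A B C where "A = count \<alpha> i + 1" "B = count (add_mset i \<alpha>) j + 1" "C = count \<alpha> (i + j) + 1"
    have nz: "of_nat A \<noteq> (0 :: complex)" "of_nat B \<noteq> (0 :: complex)" "of_nat C \<noteq> (0 :: complex)"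
      "of_nat i \<noteq> (0 :: complex)" "of_nat j \<noteq> (0 :: complex)" "of_nat (i + j) \<noteq> (0 :: complex)"
      unfolding of_nat_eq_0_iff using ij by (simp_all add: A_B_C_def)
    have "F ?\<xi> = G ?\<xi> / of_nat (j * B * (i * A * z_part \<alpha>))"
      using p ij by (subst F) (simp_all only: z_part_add_mset A_B_C_def, simp_all add: \<alpha> is_partition_def)
    moreover have "p_mult (i + j) (p_deriv i (p_deriv j F)) \<mu> = of_nat A * (of_nat B * F ?\<xi>)"
      by (simp only: \<alpha> p_mult_def p_deriv_def A_B_C_def) simp
    moreover have "z_part \<mu> = (i + j) * C * z_part \<alpha>" "count \<mu> (i + j) = C" "\<mu> - {#i + j#} = \<alpha>"
      by (simp_all add: \<alpha> z_part_add_mset A_B_C_def)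
    ultimately show ?thesis
      using nz z unfolding add_mset_commute[of i j] by (simp only: of_nat_mult) (simp add: divide_simps del: of_nat_add)
  qed (simp add: p_mult_def count_eq_zero_iff)
  moreover have "of_nat (i + j) * p_mult i (p_mult j (p_deriv (i + j) F)) \<mu>
      = of_nat (count \<mu> i) * (of_nat i * (of_nat (count (\<mu> - {#i#}) j) * (of_nat j * G (add_mset (i + j) (\<mu> - {#i, j#})))))
        / of_nat (z_part \<mu>)"
  proof (cases "i \<in># \<mu> \<and> j \<in># \<mu> - {#i#}")
    case True
    then obtain \<alpha> where \<alpha>: "\<mu> = add_mset i (add_mset j \<alpha>)"
      by (metis insert_DiffM)
    have p: "is_partition \<alpha>" using \<mu> by (simp add: \<alpha> is_partition_def)
    then have z: "of_nat (z_part \<alpha>) \<noteq> (0 :: complex)" using z_part_pos[of \<alpha>] by simp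
    let ?\<xi> = "add_mset (i + j) \<alpha>"
    define A B C where "A = count (add_mset j \<alpha>) i + 1" "B = count \<alpha> j + 1" "C = count \<alpha> (i + j) + 1"
    have nz: "of_nat A \<noteq> (0 :: complex)" "of_nat B \<noteq> (0 :: complex)" "of_nat C \<noteq> (0 :: complex)"
      "of_nat i \<noteq> (0 :: complex)" "of_nat j \<noteq> (0 :: complex)" "of_nat (i + j) \<noteq> (0 :: complex)"
      unfolding of_nat_eq_0_iff using ij by (simp_all add: A_B_C_def)
    have "F ?\<xi> = G ?\<xi> / of_nat ((i + j) * C * z_part \<alpha>)"
      using p ij by (subst F) (simp_all only: z_part_add_mset A_B_C_def, simp_all add: \<alpha> is_partition_def)
    moreover have "p_mult i (p_mult j (p_deriv (i + j) F)) \<mu> = of_nat C * F ?\<xi>"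
      by (simp only: \<alpha> p_mult_def p_deriv_def A_B_C_def) simp
    moreover have "z_part \<mu> = i * A * (j * B * z_part \<alpha>)" "count \<mu> i = A" "count (\<mu> - {#i#}) j = B" "\<mu> - {#i, j#} = \<alpha>"
      by (simp_all only: \<alpha> z_part_add_mset A_B_C_def) simp_all
    ultimately show ?thesis
      using nz z by (simp only: of_nat_mult) (simp add: divide_simps del: of_nat_add)
  next
    case False
    then have "count \<mu> i = 0 \<or> count (\<mu> - {#i#}) j = 0" by (simp only: not_in_iff de_Morgan_conj)
    moreover have "p_mult i (p_mult j (p_deriv (i + j) F)) \<mu> = 0" using False by (auto simp: p_mult_def)
    ultimately show ?thesis by (elim disjE) (simp_all only: of_nat_0 mult_zero_left mult_zero_right div_0)
  qed
  ultimately show ?thesis by (simp add: cut_join_def add_divide_distrib)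
qed

text \<open>Only positive parts are removed from the monomial, so an index 0 survives in every
  coefficient of \<open>F\<close> that is consulted.\<close>

lemma cut_join_not_partition:
  assumes "\<not> is_partition \<mu>" "1 \<le> i" "1 \<le> j" "\<And>\<xi>. \<not> is_partition \<xi> \<Longrightarrow> F \<xi> = 0"
  shows "cut_join F (i, j) \<mu> = 0"
proof -
  have \<mu>: "0 \<in># \<mu>" using assms(1) by (simp add: is_partition_def)
  have F: "F \<xi> = 0" if "0 \<in># \<xi>" for \<xi> using assms(4) that by (simp add: is_partition_def)
  have "0 \<in># \<mu> - M" if "0 \<notin># M" for M
    using that \<mu> by (simp add: in_diff_count not_in_iff)
  then show ?thesis using \<mu> assms(2,3) F by (simp add: cut_join_def p_mult_def p_deriv_def)
qed

lemma le_sum_mset: "n \<in># \<mu> \<Longrightarrow> n \<le> sum_mset \<mu>" for n :: nat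
  by (auto dest!: multi_member_split)

lemma p_mult_support: "p_mult k F \<mu> \<noteq> 0 \<Longrightarrow> k \<le> sum_mset \<mu>"
  using le_sum_mset by (auto simp: p_mult_def split: if_splits)

lemma p_mult2_support: "p_mult i (p_mult j F) \<mu> \<noteq> 0 \<Longrightarrow> i \<le> sum_mset \<mu> \<and> j \<le> sum_mset \<mu>"
  using le_sum_mset by (auto simp: p_mult_def dest: in_diffD split: if_splits)

text \<open>Confines the pairs relevant at \<open>\<mu>\<close> to a finite square with side
  \<open>sum_mset \<mu>\<close>. The same square works for all submultisets of \<open>\<mu>\<close>,
  which a bare finiteness statement would not provide.\<close>

definition degree_bounded :: "(nat \<times> nat \<Rightarrow> pseries) \<Rightarrow> bool" where
  "degree_bounded Q \<longleftrightarrow> (\<forall>i j \<mu>. Q (i, j) \<mu> \<noteq> 0 \<longrightarrow> i \<le> sum_mset \<mu> \<and> j \<le> sum_mset \<mu>)"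

lemma degree_bounded_cut_join: "degree_bounded (cut_join F)"
  unfolding degree_bounded_def
proof (intro allI impI)
  fix i j \<mu> assume "cut_join F (i, j) \<mu> \<noteq> 0"
  then have "p_mult (i + j) (p_deriv i (p_deriv j F)) \<mu> \<noteq> 0 \<or> p_mult i (p_mult j (p_deriv (i + j) F)) \<mu> \<noteq> 0"
    by (auto simp: cut_join_def)
  then show "i \<le> sum_mset \<mu> \<and> j \<le> sum_mset \<mu>"
    using p_mult_support[of "i + j"] p_mult2_support by fastforce
qed

lemma degree_bounded_formal_sum:
  assumes Q: "degree_bounded Q"
  shows "formally_summable Q ({1..} \<times> {1..})"
    and "sum_mset \<mu> \<le> N \<Longrightarrow> formal_sum Q ({1..} \<times> {1..}) \<mu> = (\<Sum>z\<in>{1..N} \<times> {1..N}. Q z \<mu>)"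
proof -
  have sub: "{z \<in> {1..} \<times> {1..}. Q z \<mu> \<noteq> 0} \<subseteq> {1..N} \<times> {1..N}" if "sum_mset \<mu> \<le> N" for \<mu> N
  proof (clarsimp)
    fix i j assume "Suc 0 \<le> i" "Suc 0 \<le> j" "Q (i, j) \<mu> \<noteq> 0"
    then show "i \<le> N \<and> j \<le> N" using Q that unfolding degree_bounded_def by (meson order_trans)
  qed
  show "formally_summable Q ({1..} \<times> {1..})"
    unfolding formally_summable_def using finite_subset[OF sub[OF order_refl]] by blast
  show "formal_sum Q ({1..} \<times> {1..}) \<mu> = (\<Sum>z\<in>{1..N} \<times> {1..N}. Q z \<mu>)" if "sum_mset \<mu> \<le> N"
    unfolding formal_sum_def by (rule sum.mono_neutral_left) (use sub[OF that] in auto)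
qed

text \<open>With the square of \<open>\<mu>\<close> used for every \<open>\<mu> - \<alpha>\<close>,
  the interchange is a swap of two finite sums.\<close>

lemma ps_mult_formal_sum:
  assumes Q: "degree_bounded Q" and EQ: "degree_bounded (\<lambda>z. ps_mult E (Q z))"
  shows "ps_mult E (formal_sum Q ({1..} \<times> {1..})) = formal_sum (\<lambda>z. ps_mult E (Q z)) ({1..} \<times> {1..})"
proof
  fix \<mu> :: "nat multiset"
  let ?B = "{1..sum_mset \<mu>} \<times> {1..sum_mset \<mu>}"
  have "ps_mult E (formal_sum Q ({1..} \<times> {1..})) \<mu> = (\<Sum>\<alpha> | \<alpha> \<subseteq># \<mu>. E \<alpha> * (\<Sum>z\<in>?B. Q z (\<mu> - \<alpha>)))"
    unfolding ps_mult_def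
  proof (rule sum.cong[OF refl])
    fix \<alpha> assume "\<alpha> \<in> {\<alpha>. \<alpha> \<subseteq># \<mu>}"
    then have "sum_mset (\<mu> - \<alpha>) \<le> sum_mset \<mu>" by (auto simp: subset_mset.le_iff_add)
    from degree_bounded_formal_sum(2)[OF Q this]
    show "E \<alpha> * formal_sum Q ({1..} \<times> {1..}) (\<mu> - \<alpha>) = E \<alpha> * (\<Sum>z\<in>?B. Q z (\<mu> - \<alpha>))"
      by (rule arg_cong)
  qed
  also have "\<dots> = (\<Sum>z\<in>?B. ps_mult E (Q z) \<mu>)"
    unfolding ps_mult_def sum_distrib_left by (rule sum.swap)
  also have "\<dots> = formal_sum (\<lambda>z. ps_mult E (Q z)) ({1..} \<times> {1..}) \<mu>"
    by (rule degree_bounded_formal_sum(2)[OF EQ order_refl, symmetric])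
  finally show "ps_mult E (formal_sum Q ({1..} \<times> {1..})) \<mu> = formal_sum (\<lambda>z. ps_mult E (Q z)) ({1..} \<times> {1..}) \<mu>" .
qed

section \<open>From sums over index pairs to sums over parts\<close>

lemma sum_mset_eq_sum_count:
  fixes g :: "'a \<Rightarrow> 'b::comm_semiring_1"
  assumes "finite S" "set_mset \<mu> \<subseteq> S"
  shows "(\<Sum>n\<in>#\<mu>. g n) = (\<Sum>n\<in>S. of_nat (count \<mu> n) * g n)"
  using assms(2)
proof (induction \<mu>)
  case (add a \<mu>)
  have "(\<Sum>n\<in>S. of_nat (count (add_mset a \<mu>) n) * g n)
      = (\<Sum>n\<in>S. (if n = a then g n else 0) + of_nat (count \<mu> n) * g n)"
    by (intro sum.cong) (auto simp: algebra_simps)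
  also have "\<dots> = g a + (\<Sum>n\<in>S. of_nat (count \<mu> n) * g n)"
    using add.prems assms(1) by (simp add: sum.distrib)
  finally show ?case using add by simp
qed simp

lemma sum_triangle:
  fixes h :: "nat \<Rightarrow> nat \<Rightarrow> 'a::comm_monoid_add"
  assumes "\<And>i j. N < i + j \<Longrightarrow> h i j = 0"
  shows "(\<Sum>i=1..N. \<Sum>j=1..N. h i j) = (\<Sum>n=1..N. \<Sum>i\<in>{1..<n}. h i (n - i))"
proof -
  have "(\<Sum>i=1..N. \<Sum>j=1..N. h i j) = (\<Sum>(i, j)\<in>{1..N} \<times> {1..N}. h i j)"
    by (rule sum.cartesian_product)
  also have "\<dots> = (\<Sum>(i, j)\<in>{(i, j). 1 \<le> i \<and> 1 \<le> j \<and> i + j \<le> N}. h i j)"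
  proof (rule sum.mono_neutral_right)
    show "\<forall>z\<in>{1..N} \<times> {1..N} - {(i, j). 1 \<le> i \<and> 1 \<le> j \<and> i + j \<le> N}. (case z of (i, j) \<Rightarrow> h i j) = 0"
      by (intro ballI) (auto intro!: assms simp: not_le[symmetric] simp del: not_le)
  qed auto
  also have "\<dots> = (\<Sum>(n, i)\<in>(SIGMA n:{1..N}. {1..<n}). h i (n - i))"
    by (rule sum.reindex_bij_witness[of _ "\<lambda>(n, i). (i, n - i)" "\<lambda>(i, j). (i + j, i)"]) auto
  also have "\<dots> = (\<Sum>n=1..N. \<Sum>i\<in>{1..<n}. h i (n - i))"
    by (simp add: sum.Sigma)
  finally show ?thesis .
qed

text \<open>On the left pairs of indices are weighted by multiplicities, on the right parts are
  chosen from the multiset, as in \<open>chi_cut_join\<close>. In the first summand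
  \<open>i + j\<close> is the part \<open>n\<close> to be cut; in the second \<open>i\<close> and
  \<open>j\<close> are two parts chosen one after the other.\<close>

lemma sum_cut_join_coeff:
  fixes G :: pseries and \<mu> :: "nat multiset"
  assumes \<mu>: "is_partition \<mu>"
  defines "N \<equiv> sum_mset \<mu>"
  shows "(\<Sum>i=1..N. \<Sum>j=1..N.
      of_nat (count \<mu> (i + j)) * (of_nat (i + j) * G (add_mset i (add_mset j (\<mu> - {#i + j#}))))
     + of_nat (count \<mu> i) * (of_nat i * (of_nat (count (\<mu> - {#i#}) j) * (of_nat j * G (add_mset (i + j) (\<mu> - {#i, j#}))))))
    = (\<Sum>n\<in>#\<mu>. of_nat n * (\<Sum>i\<in>{1..<n}. G (add_mset i (add_mset (n - i) (\<mu> - {#n#})))))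
    + (\<Sum>n\<in>#\<mu>. of_nat n * (\<Sum>m\<in>#\<mu> - {#n#}. of_nat m * G (add_mset (n + m) (\<mu> - {#n, m#}))))"
proof -
  have sub: "set_mset \<mu> \<subseteq> {1..N}"
    using le_sum_mset \<mu> by (auto simp: N_def is_partition_def Suc_le_eq intro: gr0I)
  \<comment> \<open>Writing \<open>n\<close> as \<open>i + (n - i)\<close> gives the summand the
    shape \<open>h i (n - i)\<close> of \<open>sum_triangle\<close>.\<close>
  have "(\<Sum>n\<in>#\<mu>. of_nat n * (\<Sum>i\<in>{1..<n}. G (add_mset i (add_mset (n - i) (\<mu> - {#n#})))))
      = (\<Sum>n=1..N. \<Sum>i\<in>{1..<n}. of_nat (count \<mu> (i + (n - i))) *
          (of_nat (i + (n - i)) * G (add_mset i (add_mset (n - i) (\<mu> - {#i + (n - i)#})))))"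
    unfolding sum_mset_eq_sum_count[OF finite_atLeastAtMost sub] sum_distrib_left
  proof (intro sum.cong refl)
    fix n i :: nat assume "i \<in> {1..<n}"
    then have "i + (n - i) = n" by simp
    then show "of_nat (count \<mu> n) * (of_nat n * G (add_mset i (add_mset (n - i) (\<mu> - {#n#}))))
        = of_nat (count \<mu> (i + (n - i))) *
          (of_nat (i + (n - i)) * G (add_mset i (add_mset (n - i) (\<mu> - {#i + (n - i)#}))))"
      by (simp only:)
  qed
  also have "\<dots> = (\<Sum>i=1..N. \<Sum>j=1..N.
      of_nat (count \<mu> (i + j)) * (of_nat (i + j) * G (add_mset i (add_mset j (\<mu> - {#i + j#})))))"
  proof (rule sum_triangle[symmetric])
    fix i j assume "N < i + j"
    then have "i + j \<notin># \<mu>" using sub by auto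
    then show "of_nat (count \<mu> (i + j)) * (of_nat (i + j) * G (add_mset i (add_mset j (\<mu> - {#i + j#})))) = 0"
      by (simp add: not_in_iff)
  qed
  finally have cut: "(\<Sum>n\<in>#\<mu>. of_nat n * (\<Sum>i\<in>{1..<n}. G (add_mset i (add_mset (n - i) (\<mu> - {#n#}))))) = \<dots>" .
  have "set_mset (\<mu> - {#n#}) \<subseteq> {1..N}" for n using sub by (meson in_diffD subset_iff)
  note sub' = this
  have join: "(\<Sum>n\<in>#\<mu>. of_nat n * (\<Sum>m\<in>#\<mu> - {#n#}. of_nat m * G (add_mset (n + m) (\<mu> - {#n, m#}))))
      = (\<Sum>i=1..N. \<Sum>j=1..N. of_nat (count \<mu> i) * (of_nat i * (of_nat (count (\<mu> - {#i#}) j) *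
          (of_nat j * G (add_mset (i + j) (\<mu> - {#i, j#}))))))"
    unfolding sum_mset_eq_sum_count[OF finite_atLeastAtMost sub] sum_mset_eq_sum_count[OF finite_atLeastAtMost sub'] sum_distrib_left ..
  show ?thesis unfolding cut join sum.distrib ..
qed

lemma R_bullet_coeff_eq:
  "R_bullet_coeff lam \<tau> \<mu> = (\<Sum>\<nu>\<in>partitions_of (sum_mset \<mu>). chi \<nu> \<mu> *
     (exp (\<i> * (\<tau> + 1 / 2) * of_int (kappa \<nu>) * lam / 2) * V \<nu> lam)) / of_nat (z_part \<mu>)"
  unfolding R_bullet_coeff_def sum_divide_distrib by (intro sum.cong refl) (simp only: mult.assoc times_divide_eq_left)

lemma formal_sum_cut_join_R_bullet:
  assumes \<mu>: "is_partition \<mu>"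
  shows "formal_sum (cut_join (R_bullet lam \<tau>)) ({1..} \<times> {1..}) \<mu>
    = (\<Sum>\<nu>\<in>partitions_of (sum_mset \<mu>). of_int (kappa \<nu>) * chi \<nu> \<mu> *
     (exp (\<i> * (\<tau> + 1 / 2) * of_int (kappa \<nu>) * lam / 2) * V \<nu> lam)) / of_nat (z_part \<mu>)"
proof -
  let ?N = "sum_mset \<mu>"
  let ?w = "\<lambda>\<nu>. exp (\<i> * (\<tau> + 1 / 2) * of_int (kappa \<nu>) * lam / 2) * V \<nu> lam"
  define b where "b G i j = of_nat (count \<mu> (i + j)) * (of_nat (i + j) * G (add_mset i (add_mset j (\<mu> - {#i + j#}))))
     + of_nat (count \<mu> i) * (of_nat i * (of_nat (count (\<mu> - {#i#}) j) * (of_nat j * G (add_mset (i + j) (\<mu> - {#i, j#})))))"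
    for G :: pseries and i j
  \<comment> \<open>Cutting and joining preserve the sum of the parts, so the range of
    \<open>\<nu>\<close> is fixed for all monomials involved, and by linearity the operator acts on
    each \<open>chi \<nu>\<close> separately.\<close>
  define G where "G \<xi> = (\<Sum>\<nu>\<in>partitions_of ?N. chi \<nu> \<xi> * ?w \<nu>)" for \<xi>
  have b_G: "b G i j = (\<Sum>\<nu>\<in>partitions_of ?N. b (chi \<nu>) i j * ?w \<nu>)" for i j
    by (simp only: b_def G_def sum_distrib_left sum.distrib distrib_right mult.assoc)
  have "formal_sum (cut_join (R_bullet lam \<tau>)) ({1..} \<times> {1..}) \<mu>
      = (\<Sum>(i, j)\<in>{1..?N} \<times> {1..?N}. cut_join (R_bullet lam \<tau>) (i, j) \<mu>)"
    by (simp only: degree_bounded_formal_sum(2)[OF degree_bounded_cut_join order_refl] case_prod_unfold prod.collapse)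
  also have "\<dots> = (\<Sum>(i, j)\<in>{1..?N} \<times> {1..?N}. b G i j / of_nat (z_part \<mu>))"
  proof (intro sum.cong refl, clarify)
    fix i j assume "i \<in> {1..?N}" "j \<in> {1..?N}"
    then have ij: "1 \<le> i" "1 \<le> j" by auto
    show "cut_join (R_bullet lam \<tau>) (i, j) \<mu> = b G i j / of_nat (z_part \<mu>)"
      unfolding b_def
    proof (rule cut_join_coeff[OF \<mu> ij])
      show "R_bullet lam \<tau> \<xi> = G \<xi> / of_nat (z_part \<xi>)" if "is_partition \<xi>" "sum_mset \<xi> = sum_mset \<mu>" for \<xi>
        using that by (simp only: R_bullet_def R_bullet_coeff_eq G_def if_True)
    qed
  qed
  also have "\<dots> = (\<Sum>i=1..?N. \<Sum>j=1..?N. b G i j) / of_nat (z_part \<mu>)"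
    by (simp only: sum.cartesian_product sum_divide_distrib case_prod_unfold)
  also have "(\<Sum>i=1..?N. \<Sum>j=1..?N. b G i j) = (\<Sum>\<nu>\<in>partitions_of ?N. \<Sum>i=1..?N. \<Sum>j=1..?N. b (chi \<nu>) i j * ?w \<nu>)"
    unfolding b_G by (subst (2) sum.swap, subst sum.swap) (rule refl)
  also have "\<dots> = (\<Sum>\<nu>\<in>partitions_of ?N. (\<Sum>i=1..?N. \<Sum>j=1..?N. b (chi \<nu>) i j) * ?w \<nu>)"
    by (simp only: sum_distrib_right)
  also have "\<dots> = (\<Sum>\<nu>\<in>partitions_of ?N. of_int (kappa \<nu>) * chi \<nu> \<mu> * ?w \<nu>)"
  proof (rule sum.cong[OF refl])
    fix \<nu> assume "\<nu> \<in> partitions_of ?N"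
    then have "sum_mset \<nu> = ?N" by (simp add: partitions_of_def)
    from chi_cut_join[OF \<mu> this] show "(\<Sum>i=1..?N. \<Sum>j=1..?N. b (chi \<nu>) i j) * ?w \<nu> = of_int (kappa \<nu>) * chi \<nu> \<mu> * ?w \<nu>"
      unfolding b_def sum_cut_join_coeff[OF \<mu>] by (simp only:)
  qed
  finally show ?thesis .
qed

lemma has_coeff_derivative_R_bullet:
  "has_coeff_derivative (R_bullet lam)
     (\<lambda>\<mu>. \<i> * lam / 2 * formal_sum (cut_join (R_bullet lam \<tau>)) ({1..} \<times> {1..}) \<mu>) \<tau>"
  unfolding has_coeff_derivative_def
proof
  fix \<mu>
  show "((\<lambda>s. R_bullet lam s \<mu>) has_field_derivative
      \<i> * lam / 2 * formal_sum (cut_join (R_bullet lam \<tau>)) ({1..} \<times> {1..}) \<mu>) (at \<tau>)"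
  proof (cases "is_partition \<mu>")
    case True
    then have eq: "(\<lambda>s. R_bullet lam s \<mu>) = (\<lambda>s. (\<Sum>\<nu>\<in>partitions_of (sum_mset \<mu>). chi \<nu> \<mu> *
        (exp (\<i> * (s + 1 / 2) * of_int (kappa \<nu>) * lam / 2) * V \<nu> lam)) / of_nat (z_part \<mu>))"
      by (simp only: R_bullet_def R_bullet_coeff_eq if_True)
    have "((\<lambda>s. \<Sum>\<nu>\<in>partitions_of (sum_mset \<mu>). chi \<nu> \<mu> *
        (exp (\<i> * (s + 1 / 2) * of_int (kappa \<nu>) * lam / 2) * V \<nu> lam)) has_field_derivative
        (\<Sum>\<nu>\<in>partitions_of (sum_mset \<mu>). \<i> * lam / 2 * (of_int (kappa \<nu>) * chi \<nu> \<mu> *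
        (exp (\<i> * (\<tau> + 1 / 2) * of_int (kappa \<nu>) * lam / 2) * V \<nu> lam)))) (at \<tau>)"
      by (intro DERIV_sum) (auto intro!: derivative_eq_intros simp: algebra_simps)
    from DERIV_cdivide[OF this, of "of_nat (z_part \<mu>)"] show ?thesis
      unfolding eq formal_sum_cut_join_R_bullet[OF True] by (simp only: sum_distrib_left times_divide_eq_right)
  next
    case False
    have "cut_join (R_bullet lam \<tau>) z \<mu> = 0" if "z \<in> {1..} \<times> {1..}" for z
      using that cut_join_not_partition[OF False, of _ _ "R_bullet lam \<tau>"] by (auto simp: R_bullet_def)
    then have "formal_sum (cut_join (R_bullet lam \<tau>)) ({1..} \<times> {1..}) \<mu> = 0"
      unfolding formal_sum_def by (intro sum.neutral) blast
    then show ?thesis using False by (simp add: R_bullet_def)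
  qed
qed

definition cut_join_log :: "pseries \<Rightarrow> nat \<times> nat \<Rightarrow> pseries" where
  "cut_join_log F = (\<lambda>(i, j) \<mu>. of_nat (i * j) * p_mult (i + j) (p_deriv i (p_deriv j F)) \<mu>
     + of_nat (i * j) * p_mult (i + j) (ps_mult (p_deriv i F) (p_deriv j F)) \<mu>
     + of_nat (i + j) * p_mult i (p_mult j (p_deriv (i + j) F)) \<mu>)"

lemma degree_bounded_cut_join_log: "degree_bounded (cut_join_log F)"
  unfolding degree_bounded_def
proof (intro allI impI)
  fix i j \<mu> assume "cut_join_log F (i, j) \<mu> \<noteq> 0"
  then have "p_mult (i + j) (p_deriv i (p_deriv j F)) \<mu> \<noteq> 0
      \<or> p_mult (i + j) (ps_mult (p_deriv i F) (p_deriv j F)) \<mu> \<noteq> 0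
      \<or> p_mult i (p_mult j (p_deriv (i + j) F)) \<mu> \<noteq> 0"
    by (auto simp: cut_join_log_def)
  then show "i \<le> sum_mset \<mu> \<and> j \<le> sum_mset \<mu>"
    using p_mult_support[of "i + j"] p_mult2_support by fastforce
qed

lemma p_mult_add: "p_mult k (\<lambda>\<mu>. F \<mu> + G \<mu>) = (\<lambda>\<mu>. p_mult k F \<mu> + p_mult k G \<mu>)"
  by (simp add: p_mult_def fun_eq_iff)

text \<open>Differentiating \<open>E\<close> times the \<open>j\<close>-derivative of
  \<open>L\<close> once more gives \<open>E\<close> times the sum of the mixed second derivative of
  \<open>L\<close> and the product of its two first derivatives. This is the origin of the quadratic
  term in the equation for the logarithm.\<close>

lemma ps_mult_cut_join_log:
  assumes L: "\<And>i. ps_mult E (p_deriv i L) = p_deriv i E"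
  shows "ps_mult E (cut_join_log L z) = cut_join E z"
proof -
  obtain i j where z: "z = (i, j)" by fastforce
  have "p_deriv i (p_deriv j E) = (\<lambda>\<mu>. ps_mult E (ps_mult (p_deriv i L) (p_deriv j L)) \<mu> + ps_mult E (p_deriv i (p_deriv j L)) \<mu>)"
    by (simp only: L[of j, symmetric] p_deriv_mult L[of i, symmetric] ps_mult_assoc)
  then show ?thesis
    by (simp only: z cut_join_log_def cut_join_def prod.case ps_mult_add_right ps_mult_scale_right
        p_mult_ps_mult[symmetric] L p_mult_add) (simp add: fun_eq_iff algebra_simps)
qed

theorem theorem3p2:
  fixes lam \<tau> :: complex
  shows "(\<exists>S. has_formal_sum
            (\<lambda>(i, j) \<mu>.
                of_nat (i * j) * p_mult (i + j) (p_deriv i (p_deriv j (R lam \<tau>))) \<mu>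
              + of_nat (i * j) * p_mult (i + j) (ps_mult (p_deriv i (R lam \<tau>)) (p_deriv j (R lam \<tau>))) \<mu>
              + of_nat (i + j) * p_mult i (p_mult j (p_deriv (i + j) (R lam \<tau>))) \<mu>)
            ({1..} \<times> {1..}) S
          \<and> has_coeff_derivative (R lam) (\<lambda>\<mu>. \<i> * lam / 2 * S \<mu>) \<tau>)
       \<and> (\<exists>S. has_formal_sum
            (\<lambda>(i, j) \<mu>.
                of_nat (i * j) * p_mult (i + j) (p_deriv i (p_deriv j (R_bullet lam \<tau>))) \<mu>
              + of_nat (i + j) * p_mult i (p_mult j (p_deriv (i + j) (R_bullet lam \<tau>))) \<mu>)
            ({1..} \<times> {1..}) S
          \<and> has_coeff_derivative (R_bullet lam) (\<lambda>\<mu>. \<i> * lam / 2 * S \<mu>) \<tau>)"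
proof -
  let ?A = "{1..} \<times> {1..}" and ?E = "R_bullet lam \<tau>" and ?L = "R lam \<tau>"
  let ?S = "formal_sum (cut_join_log ?L) ?A"
  note E = has_coeff_derivative_R_bullet[of lam \<tau>]
  obtain R' where R': "has_coeff_derivative (R lam) R' \<tau>"
    "ps_mult ?E R' = (\<lambda>\<mu>. \<i> * lam / 2 * formal_sum (cut_join ?E) ?A \<mu>)"
    using has_coeff_derivative_R[OF E] .
  have mult: "ps_mult ?E (cut_join_log ?L z) = cut_join ?E z" for z
    by (rule ps_mult_cut_join_log) (rule R_bullet_mult_p_deriv_R)
  \<comment> \<open>The degree bound required of the multiplied family comes for free: by
    \<open>mult\<close> that family is \<open>cut_join ?E\<close>.\<close>
  have "ps_mult ?E ?S = formal_sum (cut_join ?E) ?A"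
    using ps_mult_formal_sum[OF degree_bounded_cut_join_log, of ?E ?L] degree_bounded_cut_join[of ?E]
    by (simp only: mult)
  then have "ps_mult ?E R' = ps_mult ?E (\<lambda>\<mu>. \<i> * lam / 2 * ?S \<mu>)"
    by (simp only: R'(2) ps_mult_scale_right)
  then have "R' = (\<lambda>\<mu>. \<i> * lam / 2 * ?S \<mu>)"
    by (rule ps_mult_left_cancel[of ?E, OF R_bullet_empty])
  with R'(1) have R: "has_coeff_derivative (R lam) (\<lambda>\<mu>. \<i> * lam / 2 * ?S \<mu>) \<tau>" by simp
  have "has_formal_sum (cut_join_log ?L) ?A ?S" "has_formal_sum (cut_join ?E) ?A (formal_sum (cut_join ?E) ?A)"
    using degree_bounded_formal_sum(1)[OF degree_bounded_cut_join_log] degree_bounded_formal_sum(1)[OF degree_bounded_cut_join]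
    by (simp_all only: has_formal_sum_def simp_thms)
  with R E show ?thesis
    unfolding cut_join_log_def cut_join_def by blast
qed

end
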